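(* Let $(L,v)$ be a henselian non-trivially valued field whose residue field $Lv$ has characteristic $0$. Then $L$ admits a proper subfield $K\subsetneq L$ which is dense in $(L,v)$. Moreover, $K$ can be chosen such that the extension $L|K$ is algebraic.
   Context: Valuations are Krull valuations (arbitrary ordered abelian value groups), written additively; $vL$ denotes the value group and $Lv$ the residue field of $(L,v)$. A subfield $K$ of $L$ is dense in $(L,v)$ if for every $a\in L$ and every $\alpha\in vL$ there is $b\in K$ with $v(a-b)\geq\alpha$. *)

theory Defs
  imports "HOL-Library.Extended" "HOL-Algebra.Algebraic_Closure_Type"
begin

section \<open>Krull valuations\<close>

text \<open>
  The valued field is a type of class \<open>field\<close>; \<^term>\<open>ring_of_type_algebra\<close> is the same field as a
  record with carrier \<^term>\<open>UNIV\<close>. Valuations are additive, with values in an arbitrary ordered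
  abelian group extended by \<open>\<infinity> = v 0\<close>. The type \<^typ>\<open>'g extended\<close> also contains \<open>-\<infinity>\<close>, which is
  excluded as a value. The valuation is not assumed to be onto: \<open>vL\<close> is the set of values of non-zero
  elements, a subgroup of the ambient group.
\<close>

locale krull_valuation =
  fixes v :: "'a::field \<Rightarrow> 'g::linordered_ab_group_add extended"
  assumes not_Minf: "v x \<noteq> -\<infinity>"
    and eq_Pinf_iff: "v x = \<infinity> \<longleftrightarrow> x = 0"
    and val_mult: "v (x * y) = v x + v y"
    and val_add: "min (v x) (v y) \<le> v (x + y)"

definition value_group :: "('a::field \<Rightarrow> 'g::linordered_ab_group_add extended) \<Rightarrow> 'g set"
  where "value_group v = {\<alpha>. \<exists>x. x \<noteq> 0 \<and> v x = Fin \<alpha>}"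

definition nontrivial_valuation :: "('a::field \<Rightarrow> 'g::linordered_ab_group_add extended) \<Rightarrow> bool"
  where "nontrivial_valuation v \<longleftrightarrow> value_group v \<noteq> {0}"

definition valuation_ring :: "('a::field \<Rightarrow> 'g::linordered_ab_group_add extended) \<Rightarrow> 'a ring"
  where "valuation_ring v = ring_of_type_algebra\<lparr>carrier := {x. 0 \<le> v x}\<rparr>"

definition valuation_ideal :: "('a::field \<Rightarrow> 'g::linordered_ab_group_add extended) \<Rightarrow> 'a set"
  where "valuation_ideal v = {x. 0 < v x}"

definition residue_field :: "('a::field \<Rightarrow> 'g::linordered_ab_group_add extended) \<Rightarrow> 'a set ring"
  where "residue_field v = valuation_ring v Quot valuation_ideal v"

text \<open>
  The additive order of \<open>1\<close>; \<^const>\<open>group.ord\<close> is \<open>0\<close> on elements of infinite order.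
\<close>

definition ring_characteristic :: "('a, 'b) ring_scheme \<Rightarrow> nat"
  where "ring_characteristic R = group.ord (add_monoid R) \<one>\<^bsub>R\<^esub>"

text \<open>
  Henselian means that Hensel's Lemma holds: every approximate root in the valuation ring that is
  a simple root modulo the valuation ideal lifts to a root in the same residue class.
\<close>

definition henselian :: "('a::field \<Rightarrow> 'g::linordered_ab_group_add extended) \<Rightarrow> bool"
  where "henselian v \<longleftrightarrow>
    (\<forall>f b. (\<forall>i. coeff f i \<in> carrier (valuation_ring v)) \<longrightarrow> b \<in> carrier (valuation_ring v) \<longrightarrow>
       0 < v (poly f b) \<longrightarrow> v (poly (pderiv f) b) = 0 \<longrightarrow>
       (\<exists>a\<in>carrier (valuation_ring v). poly f a = 0 \<and> 0 < v (a - b)))"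

definition dense_subset :: "('a::field \<Rightarrow> 'g::linordered_ab_group_add extended) \<Rightarrow> 'a set \<Rightarrow> bool"
  where "dense_subset v K \<longleftrightarrow>
    (\<forall>a. \<forall>\<alpha>\<in>value_group v. \<exists>b\<in>K. Fin \<alpha> \<le> v (a - b))"

definition algebraic_extension :: "'a::field set \<Rightarrow> bool"
  where "algebraic_extension K \<longleftrightarrow> (\<forall>x. (ring.algebraic ring_of_type_algebra over K) x)"

end

theory Submission
  imports Defs
begin

text \<open>
  Call an element \<open>a\<close> and a subfield \<open>K\<^sub>0\<close> a \<^emph>\<open>seed\<close> if \<open>a\<close> lies in the closure of \<open>K\<^sub>0\<close> for the
  valuation topology but not in \<open>K\<^sub>0\<close>. The theorem has two halves: a seed yields the desired subfield,
  and there is a seed.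

  \<^emph>\<open>From a seed to a dense subfield.\<close> Enlarge \<open>K\<^sub>0\<close> to a subfield \<open>K\<close> that is maximal among those not
  containing \<open>a\<close>; then \<open>a\<close> lies in \<open>K(x)\<close> for every \<open>x\<close> outside \<open>K\<close>. This makes \<open>L|K\<close> algebraic: \<open>a\<close> is
  algebraic over \<open>K\<close> because \<open>a \<in> K(a\<^sup>2 + a)\<close>, and an \<open>x\<close> such that \<open>K(x)\<close> contains an algebraic
  element outside \<open>K\<close> is itself algebraic. It also makes \<open>K\<close> dense. Otherwise the closure \<open>N\<close> of \<open>K\<close> is
  a proper subfield; choose \<open>b\<close> outside \<open>N\<close> of the least possible degree \<open>n\<close> over \<open>N\<close>. Approximate the
  minimal polynomial of \<open>b\<close> over \<open>N\<close> by a monic polynomial \<open>g\<close> of degree \<open>n\<close> over \<open>K\<close>. As \<open>L\<close> is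
  henselian and \<open>b\<close> is a simple root, \<open>g\<close> has a root \<open>x\<close> in \<open>L\<close> close to \<open>b\<close>. Since \<open>N\<close> is closed,
  \<open>x \<notin> N\<close>, and so the choice of \<open>n\<close> makes \<open>1, x, \<dots>, x\<^sup>n\<^sup>-\<^sup>1\<close> linearly independent over \<open>N\<close>. By maximality
  \<open>a\<close> is a quotient \<open>p(x)/q(x)\<close> with \<open>p\<close> and \<open>q\<close> over \<open>K\<close> of degree below \<open>n\<close>. Now \<open>a \<in> N\<close>, whence
  comparing coefficients in \<open>p(x) = a q(x)\<close> gives \<open>a \<in> K\<close>, a contradiction
  (\<open>maximal_subfield_dense\<close>).

  \<^emph>\<open>Construction of a seed.\<close> Residue characteristic \<open>0\<close> makes the valuation trivial on the prime field
  \<open>P\<close>. If the powers of some \<open>a\<close> of positive value are cofinal, take \<open>K\<^sub>0 = P(t)\<close> with \<open>t = a\<^sup>2 + a\<close>: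
  the iteration \<open>b \<mapsto> t - b\<^sup>2\<close> inside \<open>K\<^sub>0\<close> converges to its fixed point \<open>a\<close>, while \<open>a \<notin> P(a\<^sup>2 + a)\<close>
  because \<open>a\<close> is transcendental over \<open>P\<close>. If there is no such \<open>a\<close>, fix any \<open>a\<close> of positive value and take
  a maximal set \<open>T\<close> of elements whose values lie in pairwise distinct archimedean classes above that of
  \<open>a\<close>. The values of \<open>T\<close> are cofinal, so \<open>a\<close> is a limit of elements \<open>a + t\<close> with \<open>t \<in> T\<close>. The elements
  \<open>a\<close> and \<open>t \<in> T\<close> are algebraically independent over \<open>P\<close>, hence so are \<open>a\<close> and the \<open>a + t\<close>, and \<open>a\<close> is
  not in the field \<open>K\<^sub>0\<close> generated by the latter.

  Density is expressed throughout by values of non-zero elements \<open>z\<close> instead of elements of the value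
  group, which keeps all computations inside the field.
\<close>

section \<open>Subfields and algebraic elements\<close>

text \<open>
  Subfields in terms of the operations of the type class, which the polynomials of the type class
  require; \<open>is_subfield_imp_subfield\<close> translates to the field as a record.
\<close>

definition is_subfield :: "'a::field set \<Rightarrow> bool"
  where "is_subfield K \<longleftrightarrow> 1 \<in> K \<and> (\<forall>x\<in>K. \<forall>y\<in>K. x - y \<in> K \<and> x * y \<in> K) \<and> (\<forall>x\<in>K. inverse x \<in> K)"

definition polys_over :: "'a::zero set \<Rightarrow> 'a poly set"
  where "polys_over K = {p. \<forall>i. coeff p i \<in> K}"

definition algebraic_over :: "'a::field set \<Rightarrow> 'a \<Rightarrow> bool"
  where "algebraic_over K x \<longleftrightarrow> (\<exists>p\<in>polys_over K. p \<noteq> 0 \<and> poly p x = 0)"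

text \<open>
  The simple extension \<open>K(x)\<close>. Quotients with \<open>q(x) = 0\<close> may be admitted, since they are \<open>0\<close>.
\<close>

definition adjoin :: "'a::field set \<Rightarrow> 'a \<Rightarrow> 'a set"
  where "adjoin K x = {poly p x / poly q x |p q. p \<in> polys_over K \<and> q \<in> polys_over K}"

lemma coeff_in: "p \<in> polys_over K \<Longrightarrow> coeff p i \<in> K"
  by (simp add: polys_over_def)

lemma polys_over_mono: "K \<subseteq> M \<Longrightarrow> polys_over K \<subseteq> polys_over M"
  by (auto simp: polys_over_def)

lemma algebraic_over_mono: "algebraic_over K x \<Longrightarrow> K \<subseteq> M \<Longrightarrow> algebraic_over M x"
  unfolding algebraic_over_def using polys_over_mono[of K M] by blast

context
  fixes K :: "'a::field set"
  assumes K: "is_subfield K"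
begin

lemma sub_1: "1 \<in> K" and sub_diff: "x \<in> K \<Longrightarrow> y \<in> K \<Longrightarrow> x - y \<in> K"
  and sub_mult: "x \<in> K \<Longrightarrow> y \<in> K \<Longrightarrow> x * y \<in> K" and sub_inverse: "x \<in> K \<Longrightarrow> inverse x \<in> K"
  using K by (auto simp: is_subfield_def)

lemma sub_0: "0 \<in> K"
  using sub_diff[OF sub_1 sub_1] by simp

lemma sub_minus: "x \<in> K \<Longrightarrow> - x \<in> K"
  using sub_diff[OF sub_0] by simp

lemma sub_add: "x \<in> K \<Longrightarrow> y \<in> K \<Longrightarrow> x + y \<in> K"
  using sub_diff[of x "- y"] sub_minus by simp

lemma sub_divide: "x \<in> K \<Longrightarrow> y \<in> K \<Longrightarrow> x / y \<in> K"
  by (simp add: divide_inverse sub_mult sub_inverse)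

lemma sub_power: "x \<in> K \<Longrightarrow> x ^ n \<in> K"
  by (induction n) (auto intro: sub_1 sub_mult)

lemma sub_sum: "(\<And>i. i \<in> I \<Longrightarrow> f i \<in> K) \<Longrightarrow> sum f I \<in> K"
  by (induction I rule: infinite_finite_induct) (auto intro: sub_0 sub_add)

lemma sub_of_nat: "of_nat n \<in> K"
  by (induction n) (auto intro: sub_0 sub_1 sub_add)

lemma over_0: "0 \<in> polys_over K"
  by (simp add: polys_over_def sub_0)

lemma over_pCons: "pCons c p \<in> polys_over K \<longleftrightarrow> c \<in> K \<and> p \<in> polys_over K"
proof
  assume "pCons c p \<in> polys_over K"
  then have *: "coeff (pCons c p) i \<in> K" for i
    by (simp add: polys_over_def)
  show "c \<in> K \<and> p \<in> polys_over K"
    using *[of 0] *[of "Suc _"] by (simp add: polys_over_def)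
qed (auto simp: polys_over_def coeff_pCons split: nat.split)

lemma over_1: "1 \<in> polys_over K"
  by (simp add: one_pCons over_pCons over_0 sub_1)

lemma over_add: "p \<in> polys_over K \<Longrightarrow> q \<in> polys_over K \<Longrightarrow> p + q \<in> polys_over K"
  by (simp add: polys_over_def sub_add)

lemma over_diff: "p \<in> polys_over K \<Longrightarrow> q \<in> polys_over K \<Longrightarrow> p - q \<in> polys_over K"
  by (simp add: polys_over_def sub_diff)

lemma over_smult: "c \<in> K \<Longrightarrow> p \<in> polys_over K \<Longrightarrow> smult c p \<in> polys_over K"
  by (simp add: polys_over_def sub_mult)

lemma over_mult: "p \<in> polys_over K \<Longrightarrow> q \<in> polys_over K \<Longrightarrow> p * q \<in> polys_over K"
  by (auto simp: polys_over_def coeff_mult intro!: sub_sum sub_mult)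

lemma over_power: "p \<in> polys_over K \<Longrightarrow> p ^ n \<in> polys_over K"
  by (induction n) (auto intro: over_1 over_mult)

lemma over_sum: "(\<And>i. i \<in> I \<Longrightarrow> f i \<in> polys_over K) \<Longrightarrow> sum f I \<in> polys_over K"
  by (auto simp: polys_over_def coeff_sum intro!: sub_sum)

lemma over_pderiv: "p \<in> polys_over K \<Longrightarrow> pderiv p \<in> polys_over K"
  unfolding polys_over_def by (auto simp: coeff_pderiv intro: sub_mult sub_add sub_1 sub_of_nat)

lemma over_pcompose: "p \<in> polys_over K \<Longrightarrow> q \<in> polys_over K \<Longrightarrow> pcompose p q \<in> polys_over K"
  by (induction p) (auto simp: over_pCons pcompose_pCons over_0 intro!: over_add over_mult)

lemma poly_in: "p \<in> polys_over K \<Longrightarrow> x \<in> K \<Longrightarrow> poly p x \<in> K"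
  by (induction p) (auto simp: over_pCons sub_0 intro!: sub_add sub_mult)

lemma algebraic_over_self: "x \<in> K \<Longrightarrow> algebraic_over K x"
  unfolding algebraic_over_def
  by (rule bexI[of _ "[:- x, 1:]"]) (auto simp: over_pCons over_0 sub_1 sub_minus)

lemma subset_adjoin: "K \<subseteq> adjoin K x"
proof
  fix y assume "y \<in> K"
  then show "y \<in> adjoin K x" unfolding adjoin_def
    by (intro CollectI exI[of _ "[:y:]"] exI[of _ 1]) (auto simp: over_pCons over_0 over_1)
qed

lemma generator_in_adjoin: "x \<in> adjoin K x"
  unfolding adjoin_def
  by (intro CollectI exI[of _ "[:0, 1:]"] exI[of _ 1]) (auto simp: over_pCons over_0 over_1 sub_0 sub_1)

lemma is_subfield_adjoin: "is_subfield (adjoin K x)"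
  unfolding is_subfield_def
proof (intro conjI ballI)
  show "1 \<in> adjoin K x"
    using sub_1 subset_adjoin by blast
next
  fix y z assume "y \<in> adjoin K x" "z \<in> adjoin K x"
  then obtain p q r s where y: "y = poly p x / poly q x" and z: "z = poly r x / poly s x"
    and *: "p \<in> polys_over K" "q \<in> polys_over K" "r \<in> polys_over K" "s \<in> polys_over K"
    by (auto simp: adjoin_def)
  show "y * z \<in> adjoin K x"
    unfolding adjoin_def y z using *
    by (intro CollectI exI[of _ "p * r"] exI[of _ "q * s"]) (auto simp: over_mult)
  consider "poly q x = 0" | "poly s x = 0" | "poly q x \<noteq> 0" "poly s x \<noteq> 0" by blast
  then show "y - z \<in> adjoin K x"
  proof cases
    case 1
    then have "y - z = poly (0 - r) x / poly s x"
      by (simp add: y z)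
    then show ?thesis unfolding adjoin_def using over_diff[OF over_0, of r] * by blast
  next
    case 2
    then have "y - z = poly p x / poly q x"
      by (simp add: y z)
    then show ?thesis unfolding adjoin_def using * by blast
  next
    case 3
    then have "y - z = poly (p * s - r * q) x / poly (q * s) x"
      by (simp add: y z diff_frac_eq)
    moreover have "p * s - r * q \<in> polys_over K" "q * s \<in> polys_over K"
      using * by (auto intro: over_mult over_diff)
    ultimately show ?thesis unfolding adjoin_def by blast
  qed
next
  fix y assume "y \<in> adjoin K x"
  then obtain p q where y: "y = poly p x / poly q x"
    and *: "p \<in> polys_over K" "q \<in> polys_over K"
    by (auto simp: adjoin_def)
  show "inverse y \<in> adjoin K x"
    unfolding adjoin_def y using * by (intro CollectI exI[of _ q] exI[of _ p]) auto
qed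

lemma is_subfield_imp_subfield: "subfield K ring_of_type_algebra"
proof -
  interpret R: field "ring_of_type_algebra :: 'a ring" by (rule field_from_type_algebra)
  have a_inv: "\<ominus>\<^bsub>ring_of_type_algebra\<^esub> x = - x" for x :: 'a
    by (rule R.minus_equality) (auto simp: ring_of_type_algebra_def)
  have m_inv: "inv\<^bsub>ring_of_type_algebra\<^esub> x = inverse x" if "x \<noteq> 0" for x :: 'a
    using that by (intro R.comm_inv_char) (auto simp: ring_of_type_algebra_def)
  show ?thesis
  proof (rule R.subfieldI')
    show "subring K ring_of_type_algebra"
      by (rule R.subringI, unfold a_inv)
        (auto simp: ring_of_type_algebra_def intro: sub_1 sub_minus sub_add sub_mult)
    show "inv\<^bsub>ring_of_type_algebra\<^esub> k \<in> K" if "k \<in> K - {\<zero>\<^bsub>ring_of_type_algebra\<^esub>}" for k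
    proof -
      have "k \<noteq> 0" using that by (simp add: ring_of_type_algebra_def)
      then show ?thesis using that m_inv sub_inverse by simp
    qed
  qed
qed

text \<open>
  Polynomials over a ring record are coefficient lists that start with the leading coefficient, so the
  witness is the reversed list of coefficients.
\<close>

lemma algebraic_over_imp_algebraic:
  assumes "algebraic_over K x"
  shows "(ring.algebraic ring_of_type_algebra over K) x"
proof -
  interpret R: field "ring_of_type_algebra :: 'a ring" by (rule field_from_type_algebra)
  obtain p where p: "p \<in> polys_over K" "p \<noteq> 0" "poly p x = 0"
    using assms by (auto simp: algebraic_over_def)
  have ev: "R.eval (rev cs) x = poly (Poly cs) x" for cs
  proof (induction cs)
    case Nil
    show ?case by (simp only: rev.simps R.eval.simps) (simp add: ring_of_type_algebra_def)
  next
    case (Cons c cs)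
    have carrier: "y \<in> carrier ring_of_type_algebra" for y :: 'a
      by (simp add: ring_of_type_algebra_def)
    have "R.eval (rev cs @ [c]) x
        = R.eval (rev cs) x \<otimes>\<^bsub>ring_of_type_algebra\<^esub> x \<oplus>\<^bsub>ring_of_type_algebra\<^esub> c"
      using R.eval_append_aux[of "rev cs" c x] carrier by blast
    also have "\<dots> = R.eval (rev cs) x * x + c"
      by (simp only: ring_of_type_algebra_def ring.simps monoid.simps)
    finally have "R.eval (rev cs @ [c]) x = R.eval (rev cs) x * x + c" .
    then show ?case using Cons by (simp add: mult.commute)
  qed
  have "set (rev (coeffs p)) \<subseteq> K"
    using coeff_in[OF p(1)] by (auto simp: coeffs_def)
  moreover have "hd (rev (coeffs p)) \<noteq> \<zero>\<^bsub>ring_of_type_algebra\<^esub>"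
    using p(2) by (simp add: hd_rev last_coeffs_eq_coeff_degree ring_of_type_algebra_def)
  ultimately have "rev (coeffs p) \<in> carrier (K[X]\<^bsub>ring_of_type_algebra\<^esub>)"
    by (simp add: univ_poly_carrier[symmetric] polynomial_def)
  moreover have "rev (coeffs p) \<noteq> []" using p(2) by simp
  moreover have "R.eval (rev (coeffs p)) x = \<zero>\<^bsub>ring_of_type_algebra\<^esub>"
    using ev[of "coeffs p"] p(3) by (simp add: ring_of_type_algebra_def)
  ultimately show ?thesis by (rule R.algebraicI)
qed

end


section \<open>Valuation arithmetic\<close>

context krull_valuation
begin

lemma v_0 [simp]: "v 0 = \<infinity>"
  by (simp add: eq_Pinf_iff)

lemma v_nonzero_Fin: "x \<noteq> 0 \<Longrightarrow> \<exists>g. v x = Fin g"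
  using eq_Pinf_iff[of x] not_Minf[of x] by (cases "v x") auto

lemma v_1 [simp]: "v 1 = 0"
proof -
  obtain g where "v 1 = Fin g" using v_nonzero_Fin[of 1] by auto
  then show ?thesis using val_mult[of 1 1] by (simp add: zero_extended_def)
qed

lemma v_minus [simp]: "v (- x) = v x"
proof -
  obtain g where g: "v (- 1) = Fin g" using v_nonzero_Fin[of "- 1"] by auto
  then have "Fin (g + g) = 0" using val_mult[of "- 1" "- 1"] by simp
  then have "v (- 1) = 0" using g by (simp add: zero_extended_def)
  then show ?thesis using val_mult[of "- 1" x] by simp
qed

lemma v_diff_commute: "v (x - y) = v (y - x)"
  using v_minus[of "x - y"] by simp

lemma v_mult_left_mono: "v x \<le> v y \<Longrightarrow> v (z * x) \<le> v (z * y)"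
  by (simp add: val_mult add_left_mono)

lemma v_mult_le_iff: "z \<noteq> 0 \<Longrightarrow> v (z * x) \<le> v (z * y) \<longleftrightarrow> v x \<le> v y"
  using v_mult_left_mono[of x y z] v_mult_left_mono[of "z * x" "z * y" "inverse z"]
  by (auto simp: mult.assoc[symmetric])

lemma v_mult_less_iff: "z \<noteq> 0 \<Longrightarrow> v (z * x) < v (z * y) \<longleftrightarrow> v x < v y"
  using v_mult_le_iff[of z y x] by (simp add: not_le[symmetric])

lemma v_mult_mono: "v x \<le> v y \<Longrightarrow> v z \<le> v w \<Longrightarrow> v (x * z) \<le> v (y * w)"
  by (simp add: val_mult add_mono)

lemma v_power_mono: "v x \<le> v y \<Longrightarrow> v (x ^ n) \<le> v (y ^ n)"
  by (induction n) (auto intro: v_mult_mono)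

lemma v_divide_eq: "v x = v y \<Longrightarrow> y \<noteq> 0 \<Longrightarrow> v (x / y) = 0"
  using val_mult[of y "inverse y"] by (simp add: divide_inverse val_mult)

lemma v_divide_nonneg: "v y \<le> v x \<Longrightarrow> y \<noteq> 0 \<Longrightarrow> 0 \<le> v (x / y)"
  using v_mult_le_iff[of y 1 "x / y"] by simp

lemma v_divide_pos: "v y < v x \<Longrightarrow> y \<noteq> 0 \<Longrightarrow> 0 < v (x / y)"
  using v_mult_less_iff[of y 1 "x / y"] by simp

lemma v_add_ge: "g \<le> v x \<Longrightarrow> g \<le> v y \<Longrightarrow> g \<le> v (x + y)"
  using val_add[of x y] by (meson min.boundedI order_trans)

lemma v_add_gt: "g < v x \<Longrightarrow> g < v y \<Longrightarrow> g < v (x + y)"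
  using val_add[of x y] by (metis less_le_trans min_less_iff_conj)

lemma v_diff_ge: "g \<le> v x \<Longrightarrow> g \<le> v y \<Longrightarrow> g \<le> v (x - y)"
  using v_add_ge[of g x "- y"] by simp

lemma v_add_eq: "v x < v y \<Longrightarrow> v (x + y) = v x"
  using v_add_ge[of "v x" x y] v_add_gt[of "v x" "x + y" "- y"]
  by (metis add_diff_cancel_right' antisym_conv1 less_le less_irrefl not_le uminus_add_conv_diff
      add.commute v_minus)

lemma v_mult_nonneg: "0 \<le> v x \<Longrightarrow> 0 \<le> v y \<Longrightarrow> 0 \<le> v (x * y)"
  using v_mult_mono[of 1 x 1 y] by simp

lemma v_power_nonneg: "0 \<le> v x \<Longrightarrow> 0 \<le> v (x ^ n)"
  by (induction n) (auto intro: v_mult_nonneg)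

lemma v_le_mult: "0 \<le> v y \<Longrightarrow> v x \<le> v (x * y)"
  using v_mult_mono[of x x 1 y] by simp

text \<open>
  This provides elements \<open>c\<close> that are small enough for finitely many products with \<open>c\<close> to be as small as
  prescribed.
\<close>

lemma exists_common_bound:
  assumes "z \<noteq> 0" "finite W"
  shows "\<exists>c. c \<noteq> 0 \<and> (\<forall>x\<in>W. v z \<le> v (x * c))"
  using assms(2)
proof (induction W rule: finite_induct)
  case empty
  then show ?case by (intro exI[of _ 1]) auto
next
  case (insert y W)
  then obtain c where c: "c \<noteq> 0" "\<forall>x\<in>W. v z \<le> v (x * c)" by auto
  show ?case
  proof (cases "v z \<le> v (y * c)")
    case False
    then have "y \<noteq> 0" by auto
    with False have "v c \<le> v (z / y)" using v_mult_le_iff[of y c "z / y"] by auto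
    then have "\<forall>x\<in>W. v z \<le> v (x * (z / y))"
      using c(2) v_mult_left_mono order_trans by blast
    then show ?thesis using \<open>y \<noteq> 0\<close> \<open>z \<noteq> 0\<close> by (intro exI[of _ "z / y"]) auto
  qed (use c in auto)
qed

end

section \<open>The closure of a subfield\<close>

definition valuation_closure :: "('a::field \<Rightarrow> 'g::linordered_ab_group_add extended) \<Rightarrow> 'a set \<Rightarrow> 'a set"
  where "valuation_closure v K = {x. \<forall>z. z \<noteq> 0 \<longrightarrow> (\<exists>b\<in>K. v z \<le> v (x - b))}"

context krull_valuation
begin

lemma valuation_closure_mono: "K \<subseteq> M \<Longrightarrow> valuation_closure v K \<subseteq> valuation_closure v M"
  unfolding valuation_closure_def by blast

lemma subset_valuation_closure: "K \<subseteq> valuation_closure v K"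
  unfolding valuation_closure_def by (auto intro!: bexI)

lemma valuation_closure_approx:
  assumes "x \<in> valuation_closure v K" "z \<noteq> 0"
  obtains b where "b \<in> K" "v z \<le> v (x - b)"
  using assms by (auto simp: valuation_closure_def)

lemma valuation_closure_idem: "valuation_closure v (valuation_closure v K) = valuation_closure v K"
proof
  show "valuation_closure v (valuation_closure v K) \<subseteq> valuation_closure v K"
  proof
    fix x assume x: "x \<in> valuation_closure v (valuation_closure v K)"
    show "x \<in> valuation_closure v K"
      unfolding valuation_closure_def
    proof (intro CollectI allI impI)
      fix z :: 'a assume "z \<noteq> 0"
      then obtain y b where "v z \<le> v (x - y)" "v z \<le> v (y - b)" "b \<in> K"
        using valuation_closure_approx[OF x] valuation_closure_approx by metis
      then show "\<exists>b\<in>K. v z \<le> v (x - b)"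
        using v_add_ge[of "v z" "x - y" "y - b"] by auto
    qed
  qed
qed (rule subset_valuation_closure)

text \<open>
  Field operations are continuous. An element \<open>w\<close> of positive value is needed for inverses: an
  approximation of \<open>x\<close> must be better than \<open>v x\<close> to have the same value as \<open>x\<close>.
\<close>

lemma is_subfield_valuation_closure:
  assumes K: "is_subfield K" and w: "w \<noteq> 0" "0 < v w"
  shows "is_subfield (valuation_closure v K)"
  unfolding is_subfield_def
proof (intro conjI ballI)
  show "1 \<in> valuation_closure v K"
    using sub_1[OF K] subset_valuation_closure by blast
next
  fix x y assume x: "x \<in> valuation_closure v K" and y: "y \<in> valuation_closure v K"
  show "x - y \<in> valuation_closure v K"
    unfolding valuation_closure_def
  proof (intro CollectI allI impI)
    fix z :: 'a assume z: "z \<noteq> 0"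
    obtain b c where "b \<in> K" "c \<in> K" "v z \<le> v (x - b)" "v z \<le> v (y - c)"
      using valuation_closure_approx[OF x z] valuation_closure_approx[OF y z] by metis
    then show "\<exists>b\<in>K. v z \<le> v (x - y - b)"
      using v_diff_ge[of "v z" "x - b" "y - c"] sub_diff[OF K, of b c]
      by (intro bexI[of _ "b - c"]) (auto simp: algebra_simps)
  qed
  show "x * y \<in> valuation_closure v K"
    unfolding valuation_closure_def
  proof (intro CollectI allI impI)
    fix z :: 'a assume z: "z \<noteq> 0"
    obtain d where d: "d \<noteq> 0" "v z \<le> v (x * d)"
      using exists_common_bound[OF z, of "{x}"] by auto
    obtain c where c: "c \<in> K" "v d \<le> v (y - c)"
      using valuation_closure_approx[OF y d(1)] .
    obtain e where e: "e \<noteq> 0" "v z \<le> v (c * e)"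
      using exists_common_bound[OF z, of "{c}"] by auto
    obtain b where b: "b \<in> K" "v e \<le> v (x - b)"
      using valuation_closure_approx[OF x e(1)] .
    have "v z \<le> v (x * (y - c))" "v z \<le> v (c * (x - b))"
      using d(2) v_mult_left_mono[OF c(2)] e(2) v_mult_left_mono[OF b(2)] order_trans by blast+
    then have "v z \<le> v (x * y - c * b)"
      using v_add_ge[of "v z" "x * (y - c)" "c * (x - b)"] by (simp add: algebra_simps)
    then show "\<exists>b\<in>K. v z \<le> v (x * y - b)"
      using sub_mult[OF K c(1) b(1)] by blast
  qed
next
  fix x assume x: "x \<in> valuation_closure v K"
  show "inverse x \<in> valuation_closure v K"
  proof (cases "x = 0")
    case False
    show ?thesis
      unfolding valuation_closure_def
    proof (intro CollectI allI impI)
      fix z :: 'a assume z: "z \<noteq> 0"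
      obtain d where d: "d \<noteq> 0" "v (z * x * x) \<le> v d" "v (w * x) \<le> v d"
        using linorder_class.linear[of "v (z * x * x)" "v (w * x)"] z False w(1)
        by (metis mult_eq_0_iff order_refl)
      obtain b where b: "b \<in> K" "v d \<le> v (x - b)"
        using valuation_closure_approx[OF x d(1)] .
      have "v x < v (w * x)"
        using v_mult_less_iff[OF False, of 1 w] w(2) by (simp add: mult.commute)
      then have "v x < v (b - x)" using d(3) b(2) by (simp add: v_diff_commute)
      then have vb: "v b = v x" using v_add_eq[of x "b - x"] by simp
      then have b0: "b \<noteq> 0" using False eq_Pinf_iff by metis
      have diff: "inverse x - inverse b = inverse x * inverse b * (b - x)"
        using b0 False by (simp add: field_simps)
      have "v (z * x * x) \<le> v (b - x)"
        using d(2) b(2) by (simp add: v_diff_commute)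
      then have "v (z * x * b) \<le> v (b - x)" by (simp add: val_mult vb)
      moreover have "x * b * (inverse x * inverse b * (b - x)) = b - x"
        using b0 False by (simp add: field_simps)
      moreover have "z * x * b = x * b * z" by simp
      ultimately have "v (x * b * z) \<le> v (x * b * (inverse x * inverse b * (b - x)))"
        by metis
      then have "v z \<le> v (inverse x * inverse b * (b - x))"
        using v_mult_le_iff b0 False by (metis mult_eq_0_iff)
      then show "\<exists>b\<in>K. v z \<le> v (inverse x - b)"
        using sub_inverse[OF K b(1)] diff by (intro bexI[of _ "inverse b"]) auto
    qed
  next
    case True
    then show ?thesis using sub_0[OF K] subset_valuation_closure by auto
  qed
qed

section \<open>Roots of nearby polynomials\<close>

text \<open>
  The Taylor expansion at \<open>b\<close> is continuous in the coefficients, uniformly on polynomials of bounded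
  degree.
\<close>

lemma taylor_shift_small:
  assumes "z \<noteq> 0"
  shows "\<exists>d. d \<noteq> 0 \<and> (\<forall>p. degree p \<le> n \<longrightarrow> (\<forall>i. v d \<le> v (coeff p i)) \<longrightarrow>
           (\<forall>i. v z \<le> v (coeff (pcompose p [:b, 1:]) i)))"
  using assms
proof (induction n arbitrary: z)
  case 0
  show ?case
  proof (intro exI[of _ z] conjI allI impI)
    fix p i assume "degree p \<le> 0" and *: "\<forall>i. v z \<le> v (coeff p i)"
    then obtain a where "p = [:a:]" by (metis degree_eq_zeroE le_zero_eq)
    then show "v z \<le> v (coeff (pcompose p [:b, 1:]) i)" using *[rule_format, of i] by simp
  qed (use 0 in simp)
next
  case (Suc n)
  obtain c where c: "c \<noteq> 0" "v z \<le> v c" "v z \<le> v (b * c)"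
    using exists_common_bound[OF Suc.prems, of "{1, b}"] by auto
  obtain d where d: "d \<noteq> 0" "\<And>p i. degree p \<le> n \<Longrightarrow> (\<forall>i. v d \<le> v (coeff p i)) \<Longrightarrow>
           v c \<le> v (coeff (pcompose p [:b, 1:]) i)"
    using Suc.IH[OF c(1)] by blast
  obtain e where e: "e \<noteq> 0" "v d \<le> v e" "v z \<le> v e"
    using linorder_class.linear[of "v d" "v z"] d(1) Suc.prems by (metis order_refl)
  show ?case
  proof (intro exI[of _ e] conjI allI impI)
    fix p i assume deg: "degree p \<le> Suc n" and *: "\<forall>i. v e \<le> v (coeff p i)"
    obtain a q where p: "p = pCons a q" by (cases p)
    have "degree q \<le> n" using deg by (cases "q = 0") (auto simp: p)
    moreover have "v e \<le> v (coeff q i)" for i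
      using *[rule_format, of "Suc i"] by (simp add: p)
    then have "\<forall>i. v d \<le> v (coeff q i)" using e(2) order_trans by blast
    ultimately have q: "v c \<le> v (coeff (pcompose q [:b, 1:]) i)" for i
      using d(2) by blast
    let ?Q = "pcompose q [:b, 1:]"
    have "v z \<le> v (coeff [:a:] i)"
      using *[rule_format, of 0] e(3) by (auto simp: p coeff_pCons split: nat.split)
    moreover have "v z \<le> v (b * coeff ?Q i)" for i
      using c(3) v_mult_left_mono[OF q[of i], of b] by simp
    moreover have "v z \<le> v (coeff (pCons 0 ?Q) i)"
      using c(2) q by (auto simp: coeff_pCons split: nat.split intro: order_trans)
    ultimately show "v z \<le> v (coeff (pcompose p [:b, 1:]) i)"
      by (simp add: p pcompose_pCons v_add_ge)
  qed (use e in simp)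
qed

text \<open>
  Continuity of simple roots. Substituting \<open>b + c Y\<close> with \<open>c\<close> small and dividing by \<open>c f'(b)\<close> turns \<open>f\<close>
  into \<open>Y\<close> plus higher terms with integral coefficients. For \<open>g\<close> close to \<open>f\<close> the same substitution gives
  a polynomial with integral coefficients which is \<open>Y\<close> in degrees \<open>0\<close> and \<open>1\<close>, up to elements of the
  valuation ideal. Hensel's Lemma at \<open>0\<close> then provides a root \<open>y\<close>, and \<open>b + c y\<close> is the root of \<open>g\<close>.
\<close>

lemma henselian_root_near:
  assumes hens: "henselian v" and root: "poly f b = 0" and simple: "poly (pderiv f) b \<noteq> 0"
    and z: "z \<noteq> 0" and w: "w \<noteq> 0" "0 < v w"
  shows "\<exists>d. d \<noteq> 0 \<and> (\<forall>g. degree g \<le> degree f \<longrightarrow> (\<forall>i. v d \<le> v (coeff (g - f) i)) \<longrightarrow>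
           (\<exists>x. poly g x = 0 \<and> v z \<le> v (x - b)))"
proof -
  define F where "F = pcompose f [:b, 1:]"
  define e where "e = poly (pderiv f) b"
  have e: "e \<noteq> 0" using simple by (simp add: e_def)
  have coeff_0: "coeff (pcompose g [:b, 1:]) 0 = poly g b" for g
    by (simp add: poly_0_coeff_0[symmetric] poly_pcompose)
  have coeff_1: "coeff (pcompose g [:b, 1:]) (Suc 0) = poly (pderiv g) b" for g
    using coeff_0[of "pderiv g"] coeff_pderiv[of "pcompose g [:b, 1:]" 0]
    by (simp add: pderiv_pcompose pderiv_pCons)
  have F0: "coeff F 0 = 0" using coeff_0[of f] by (simp add: F_def root)
  have F1: "coeff F (Suc 0) = e" using coeff_1[of f] by (simp add: F_def e_def)
  \<comment> \<open>\<open>c\<close> is so small that \<open>f(b + c Y) / (c e) = Y + \<dots>\<close> has integral coefficients.\<close>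
  obtain c1 where c1: "c1 \<noteq> 0" "\<forall>x\<in>coeff F ` {..degree F}. v e \<le> v (x * c1)"
    using exists_common_bound[OF e, of "coeff F ` {..degree F}"] by auto
  obtain c2 where c2: "c2 \<noteq> 0" "v z \<le> v c2" "v 1 \<le> v c2"
    using linorder_class.linear[of "v z" "v 1"] z by (metis order_refl one_neq_zero)
  obtain c where c: "c \<noteq> 0" "v c1 \<le> v c" "v c2 \<le> v c"
    using linorder_class.linear[of "v c1" "v c2"] c1(1) c2(1) by (metis order_refl)
  have c_int: "0 \<le> v c" using c(3) c2(3) by simp
  have Fc: "v e \<le> v (c * coeff F i)" for i
  proof (cases "i \<le> degree F")
    case True
    then have "v e \<le> v (coeff F i * c1)" using c1(2) by auto
    also have "\<dots> \<le> v (coeff F i * c)" using c(2) by (rule v_mult_left_mono)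
    finally show ?thesis by (simp add: mult.commute)
  qed (simp add: coeff_eq_0)
  obtain d where d: "d \<noteq> 0" "\<And>p i. degree p \<le> degree f \<Longrightarrow> (\<forall>i. v d \<le> v (coeff p i)) \<Longrightarrow>
      v (w * c * e) \<le> v (coeff (pcompose p [:b, 1:]) i)"
    using taylor_shift_small[of "w * c * e" "degree f" b] w(1) c(1) e by auto
  have "\<exists>x. poly g x = 0 \<and> v z \<le> v (x - b)"
    if g: "degree g \<le> degree f" "\<forall>i. v d \<le> v (coeff (g - f) i)" for g
  proof -
    define D where "D = pcompose (g - f) [:b, 1:]"
    have D: "v (w * c * e) \<le> v (coeff D i)" for i
      unfolding D_def using g by (intro d(2)) (auto intro: degree_diff_le)
    define h where "h = smult (inverse (c * e)) (pcompose g [:b, c:])"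
    have shift: "pcompose g [:b, c:] = pcompose (F + D) [:0, c:]"
    proof -
      have "pcompose (F + D) [:0, c:] = pcompose (pcompose g [:b, 1:]) [:0, c:]"
        by (simp add: F_def D_def pcompose_diff)
      also have "\<dots> = pcompose g (pcompose [:b, 1:] [:0, c:])" by (rule pcompose_assoc[symmetric])
      finally show ?thesis by (simp add: pcompose_pCons)
    qed
    have coeff_h: "coeff h i = c ^ i * coeff F i / (c * e) + c ^ i * (coeff D i / (c * e))" for i
      by (simp add: h_def shift coeff_pcompose_linear distrib_left add_divide_distrib
          divide_inverse mult_ac)
    have small: "0 < v (c ^ i * (coeff D i / (c * e)))" for i
    proof -
      have "v w \<le> v (coeff D i / (c * e))"
        using D[of i] v_mult_le_iff[of "c * e" w "coeff D i / (c * e)"] c(1) e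
        by (simp add: mult_ac)
      also have "\<dots> \<le> v (c ^ i * (coeff D i / (c * e)))"
        using v_le_mult[OF v_power_nonneg[OF c_int], of "coeff D i / (c * e)" i]
        by (simp only: mult.commute)
      finally show ?thesis using w(2) by simp
    qed
    have h0: "0 < v (poly h 0)"
      using small[of 0] by (simp add: poly_0_coeff_0 coeff_h F0)
    have "coeff h (Suc 0) = 1 + c ^ 1 * (coeff D (Suc 0) / (c * e))"
      using c(1) e by (simp add: coeff_h F1)
    then have h1: "v (poly (pderiv h) 0) = 0"
      using v_add_eq[of 1 "c ^ 1 * (coeff D (Suc 0) / (c * e))"] small[of "Suc 0"]
      by (simp add: poly_0_coeff_0 coeff_pderiv)
    have "0 \<le> v (coeff h i)" for i
    proof -
      consider "i = 0" | "i = Suc 0" | j where "i = Suc (Suc j)" by (metis not0_implies_Suc)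
      then have "0 \<le> v (c ^ i * coeff F i / (c * e))"
      proof cases
        case 3
        then have "c ^ i * coeff F i / (c * e) = c ^ j * (c * coeff F i / e)"
          using c(1) by simp
        then show ?thesis
          using v_mult_nonneg[OF v_power_nonneg[OF c_int] v_divide_nonneg[OF Fc e]] by simp
      qed (use F0 F1 c(1) e in auto)
      then show ?thesis using small[of i] by (auto simp: coeff_h intro: v_add_ge)
    qed
    then obtain y where y: "poly h y = 0" "0 < v (y - 0)"
      using hens[unfolded henselian_def, rule_format, of h 0] h0 h1
      by (auto simp: valuation_ring_def)
    have "poly g (b + c * y) = 0"
      using y(1) c(1) e by (simp add: h_def poly_pcompose mult.commute)
    moreover have "v z \<le> v (b + c * y - b)"
      using v_le_mult[of y c] y(2) c(3) c2(2) by (auto intro: order_trans less_imp_le)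
    ultimately show ?thesis by blast
  qed
  then show ?thesis using d(1) by blast
qed

end


section \<open>Subfields maximal without a given element\<close>

lemma exists_maximal_subfield_avoiding:
  assumes "is_subfield K0" "a \<notin> K0"
  shows "\<exists>K. is_subfield K \<and> K0 \<subseteq> K \<and> a \<notin> K \<and> (\<forall>x. x \<notin> K \<longrightarrow> a \<in> adjoin K x)"
proof -
  define \<F> where "\<F> = {K. is_subfield K \<and> K0 \<subseteq> K \<and> a \<notin> K}"
  have "\<exists>M\<in>\<F>. \<forall>Y\<in>\<F>. M \<subseteq> Y \<longrightarrow> Y = M"
  proof (rule subset_Zorn_nonempty)
    show "\<F> \<noteq> {}" using assms by (auto simp: \<F>_def)
    fix \<C> assume ne: "\<C> \<noteq> {}" and chain: "subset.chain \<F> \<C>"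
    have sub: "is_subfield K" "K0 \<subseteq> K" "a \<notin> K" if "K \<in> \<C>" for K
      using chain that by (auto simp: subset.chain_def \<F>_def)
    have common: "\<exists>K\<in>\<C>. x \<in> K \<and> y \<in> K" if xy: "x \<in> \<Union>\<C>" "y \<in> \<Union>\<C>" for x y
    proof -
      obtain K M where "K \<in> \<C>" "M \<in> \<C>" "x \<in> K" "y \<in> M" using xy by blast
      moreover have "K \<subseteq> M \<or> M \<subseteq> K"
        using chain calculation by (auto simp: subset.chain_def)
      ultimately show ?thesis by blast
    qed
    have "is_subfield (\<Union>\<C>)"
      unfolding is_subfield_def
    proof (intro conjI ballI)
      show "1 \<in> \<Union>\<C>" using ne sub(1) sub_1 by blast
    next
      fix x y assume "x \<in> \<Union>\<C>" "y \<in> \<Union>\<C>"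
      then obtain K where "K \<in> \<C>" "x \<in> K" "y \<in> K" using common by blast
      then show "x - y \<in> \<Union>\<C>" "x * y \<in> \<Union>\<C>"
        using sub_diff[OF sub(1)] sub_mult[OF sub(1)] by blast+
    next
      fix x assume "x \<in> \<Union>\<C>"
      then show "inverse x \<in> \<Union>\<C>" using sub(1) sub_inverse by blast
    qed
    then show "\<Union>\<C> \<in> \<F>" using ne sub(2,3) by (auto simp: \<F>_def)
  qed
  then obtain K where K: "is_subfield K" "K0 \<subseteq> K" "a \<notin> K"
    and max: "\<And>M. is_subfield M \<Longrightarrow> a \<notin> M \<Longrightarrow> K \<subseteq> M \<Longrightarrow> M = K"
    by (auto simp: \<F>_def)
  have "a \<in> adjoin K x" if "x \<notin> K" for x
    using max[OF is_subfield_adjoin[OF K(1)], of x] subset_adjoin[OF K(1), of x]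
      generator_in_adjoin[OF K(1), of x] that by blast
  then show ?thesis using K by blast
qed

text \<open>
  Clearing the denominator gives an equation \<open>a q(a\<^sup>2 + a) = p(a\<^sup>2 + a)\<close>, whose two sides have odd and
  even degree as polynomials in \<open>a\<close>. It serves twice: to show that \<open>a\<close> is algebraic over a field
  maximal without it, and that a transcendental \<open>a\<close> is not in \<open>P(a\<^sup>2 + a)\<close>.
\<close>

lemma algebraic_over_if_in_adjoin_square_plus_self:
  assumes K: "is_subfield K" and a: "a \<in> adjoin K (a ^ 2 + a)"
  shows "algebraic_over K a"
proof -
  define H where "H = [:0, 1, 1::'a:]"
  obtain p q where pq: "p \<in> polys_over K" "q \<in> polys_over K"
    and a_eq: "a = poly p (a ^ 2 + a) / poly q (a ^ 2 + a)"
    using a by (auto simp: adjoin_def)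
  have H: "poly H a = a ^ 2 + a" "degree H = 2" "H \<in> polys_over K"
    by (auto simp: H_def power2_eq_square algebra_simps over_pCons[OF K] over_0[OF K] sub_0[OF K] sub_1[OF K])
  show ?thesis
  proof (cases "poly q (a ^ 2 + a) = 0")
    case True
    then show ?thesis using a_eq algebraic_over_self[OF K sub_0[OF K]] by simp
  next
    case False
    define r where "r = pCons 0 (pcompose q H) - pcompose p H"
    have "poly r a = 0"
      using a_eq False by (simp add: r_def poly_pcompose H(1) field_simps)
    moreover have "r \<in> polys_over K"
      unfolding r_def using pq H(3) by (intro over_diff[OF K])
        (auto simp: over_pCons[OF K] sub_0[OF K] intro: over_pcompose[OF K])
    \<comment> \<open>The two parts of \<open>r\<close> have degrees of different parity.\<close>
    moreover have "r \<noteq> 0"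
    proof
      assume "r = 0"
      then have eq: "pCons 0 (pcompose q H) = pcompose p H" by (simp add: r_def)
      have "q \<noteq> 0" using False by auto
      then have "pcompose q H \<noteq> 0" using pcompose_eq_0[of q H] H(2) by auto
      then have "Suc (degree q * 2) = degree p * 2"
        using arg_cong[OF eq, of degree] H(2) by (simp add: degree_pcompose)
      then show False by presburger
    qed
    ultimately show ?thesis by (auto simp: algebraic_over_def)
  qed
qed

text \<open>
  Let \<open>a = p(x)/q(x)\<close> and \<open>m(a) = 0\<close>. Clearing denominators in \<open>m(p/q)\<close> gives a polynomial over \<open>K\<close> that
  vanishes at \<open>x\<close>. If it were zero, then \<open>p/q\<close> would take values in the finite set of roots of \<open>m\<close> at
  infinitely many points of \<open>K\<close>, so it would take one of them infinitely often and be constant, with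
  a value in \<open>K\<close>; but then \<open>a \<in> K\<close>.
\<close>

lemma algebraic_over_if_algebraic_in_adjoin:
  assumes K: "is_subfield K" "infinite K" and a: "a \<in> adjoin K x" "a \<notin> K" "algebraic_over K a"
  shows "algebraic_over K x"
proof -
  obtain p q where pq: "p \<in> polys_over K" "q \<in> polys_over K"
    and a_eq: "a = poly p x / poly q x"
    using a(1) by (auto simp: adjoin_def)
  obtain m where m: "m \<in> polys_over K" "m \<noteq> 0" "poly m a = 0"
    using a(3) by (auto simp: algebraic_over_def)
  have qx: "poly q x \<noteq> 0"
    using a(2) a_eq sub_0[OF K(1)] by auto
  \<comment> \<open>\<open>M\<close> is \<open>m(p/q)\<close> with denominators cleared.\<close>
  define M where "M = (\<Sum>i\<le>degree m. smult (coeff m i) (p ^ i * q ^ (degree m - i)))"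
  have poly_M: "poly M y = poly q y ^ degree m * poly m (poly p y / poly q y)"
    if "poly q y \<noteq> 0" for y
  proof -
    have "coeff m i * (poly p y ^ i * poly q y ^ (degree m - i))
        = poly q y ^ degree m * (coeff m i * (poly p y / poly q y) ^ i)" if "i \<le> degree m" for i
      using that \<open>poly q y \<noteq> 0\<close> by (simp add: power_divide power_diff)
    then show ?thesis
      unfolding M_def poly_sum poly_altdef[of m] sum_distrib_left poly_smult poly_mult poly_power
      by (intro sum.cong) auto
  qed
  have "M \<noteq> 0"
  proof
    assume "M = 0"
    define C where "C = {c \<in> K. poly q c \<noteq> 0}"
    define \<phi> where "\<phi> = (\<lambda>c. poly p c / poly q c)"
    have "q \<noteq> 0" using qx by auto
    then have "finite {c. poly q c = 0}" by (rule poly_roots_finite)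
    moreover have "K \<subseteq> C \<union> {c. poly q c = 0}" by (auto simp: C_def)
    ultimately have "infinite C" using K(2) finite_subset by blast
    have "\<phi> ` C \<subseteq> {y. poly m y = 0}"
      using poly_M \<open>M = 0\<close> by (auto simp: C_def \<phi>_def)
    then have "finite (\<phi> ` C)"
      using poly_roots_finite[OF m(2)] finite_subset by blast
    then obtain c where c: "c \<in> C" "infinite {y \<in> C. \<phi> y = \<phi> c}"
      using pigeonhole_infinite[OF \<open>infinite C\<close>] by blast
    have "{y \<in> C. \<phi> y = \<phi> c} \<subseteq> {y. poly (p - smult (\<phi> c) q) y = 0}"
      by (auto simp: C_def \<phi>_def[abs_def] field_simps)
    then have "infinite {y. poly (p - smult (\<phi> c) q) y = 0}"
      using c(2) finite_subset by blast
    then have "p - smult (\<phi> c) q = 0" using poly_roots_finite by blast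
    then have "p = smult (\<phi> c) q" by simp
    then have "a = \<phi> c" using a_eq qx by simp
    then have "a \<in> K"
      using c(1) by (simp add: \<phi>_def C_def sub_divide[OF K(1)] poly_in[OF K(1)] pq)
    then show False using a(2) by blast
  qed
  moreover have "M \<in> polys_over K"
    unfolding M_def using pq m(1)
    by (intro over_sum[OF K(1)] over_smult[OF K(1)] over_mult[OF K(1)] over_power[OF K(1)] coeff_in)
  moreover have "poly M x = 0"
    using poly_M[OF qx] a_eq m(3) by simp
  ultimately show ?thesis by (auto simp: algebraic_over_def)
qed

text \<open>
  The remainder of \<open>p\<close> modulo \<open>g\<close>, by induction on \<open>p\<close> so as to keep the coefficients in \<open>K\<close>.
\<close>

lemma remainder_at_root:
  assumes K: "is_subfield K" and g: "g \<in> polys_over K" "lead_coeff g = 1" "degree g > 0" "poly g x = 0"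
    and p: "p \<in> polys_over K"
  shows "\<exists>r\<in>polys_over K. degree r < degree g \<and> poly r x = poly p x"
  using p
proof (induction p)
  case 0
  then show ?case using g(3) by (intro bexI[of _ 0]) auto
next
  case (pCons c p)
  then obtain r where r: "r \<in> polys_over K" "degree r < degree g" "poly r x = poly p x"
    by (auto simp: over_pCons[OF K])
  define s where "s = pCons c r"
  define t where "t = s - smult (coeff s (degree g)) g"
  have s: "s \<in> polys_over K" using r(1) pCons.prems by (simp add: s_def over_pCons[OF K])
  then have "t \<in> polys_over K"
    unfolding t_def by (intro over_diff[OF K] over_smult[OF K] coeff_in g(1))
  moreover have "degree t < degree g"
  proof -
    have "degree s \<le> degree g" using r(2) by (simp add: s_def)
    then have "degree t \<le> degree g" unfolding t_def by (intro degree_diff_le) auto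
    moreover have "coeff t (degree g) = 0" using g(2) by (simp add: t_def)
    ultimately show ?thesis using eq_zero_or_degree_less[of t "degree g"] g(3) by auto
  qed
  moreover have "poly t x = poly (pCons c p) x" using g(4) r(3) by (simp add: t_def s_def)
  ultimately show ?case by blast
qed

context krull_valuation
begin

text \<open>
  If the closure \<open>N\<close> of \<open>K\<close> were proper, an element \<open>b\<close> of least degree over \<open>N\<close> outside \<open>N\<close> could be moved
  to a nearby root \<open>x\<close> of a polynomial over \<open>K\<close> of the same degree. Then \<open>K(x)\<close> and \<open>N\<close> are linearly
  disjoint over \<open>K\<close>, although both contain \<open>a\<close>.
\<close>

lemma maximal_subfield_dense:
  assumes hens: "henselian v" and char_0: "\<And>n. n > 0 \<Longrightarrow> of_nat n \<noteq> (0::'a)"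
    and w: "w \<noteq> 0" "0 < v w"
    and K: "is_subfield K" and alg: "\<And>x. algebraic_over K x"
    and a: "a \<notin> K" "a \<in> valuation_closure v K" and max: "\<And>x. x \<notin> K \<Longrightarrow> a \<in> adjoin K x"
  shows "valuation_closure v K = UNIV"
proof (rule ccontr)
  define N where "N = valuation_closure v K"
  assume "valuation_closure v K \<noteq> UNIV"
  then obtain b0 where "b0 \<notin> N" by (auto simp: N_def)
  have N: "is_subfield N" unfolding N_def by (rule is_subfield_valuation_closure[OF K w])
  have KN: "K \<subseteq> N" unfolding N_def by (rule subset_valuation_closure)
  define P where "P n \<longleftrightarrow> (\<exists>x f. x \<notin> N \<and> f \<in> polys_over N \<and> f \<noteq> 0 \<and> poly f x = 0 \<and> degree f = n)"
    for n
  have "\<exists>n. P n"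
    using \<open>b0 \<notin> N\<close> algebraic_over_mono[OF alg KN, of b0] by (auto simp: P_def algebraic_over_def)
  define n where "n = (LEAST n. P n)"
  have "P n" unfolding n_def using \<open>\<exists>n. P n\<close> by (rule LeastI_ex)
  then obtain b f0 where b: "b \<notin> N" and f0: "f0 \<in> polys_over N" "f0 \<noteq> 0" "poly f0 b = 0" "degree f0 = n"
    by (auto simp: P_def)
  have minimal: "h = 0" if "x \<notin> N" "h \<in> polys_over N" "poly h x = 0" "degree h < n" for x h
    using not_less_Least[of "degree h" P] that unfolding n_def P_def by blast
  define f where "f = smult (inverse (lead_coeff f0)) f0"
  have f: "f \<in> polys_over N" "lead_coeff f = 1" "degree f = n" "poly f b = 0"
    using f0 over_smult[OF N sub_inverse[OF N coeff_in[OF f0(1)]] f0(1)] by (auto simp: f_def)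
  have "n \<noteq> 0"
  proof
    assume "n = 0"
    then obtain c where "f = [:c:]" using f(3) degree_eq_zeroE by metis
    then show False using f(2,4) by simp
  qed
  have sep: "poly (pderiv f) b \<noteq> 0"
  proof
    assume "poly (pderiv f) b = 0"
    moreover have "degree (pderiv f) < n"
    proof (rule degree_lessI)
      show "pderiv f \<noteq> 0 \<or> n > 0" using \<open>n \<noteq> 0\<close> by simp
      show "\<forall>k\<ge>n. coeff (pderiv f) k = 0" using f(3) by (auto simp: coeff_pderiv coeff_eq_0)
    qed
    ultimately have "pderiv f = 0" using minimal[OF b over_pderiv[OF N f(1)]] by blast
    then have "coeff (pderiv f) (n - 1) = 0" by simp
    then show False
      using f(2,3) char_0[of n] \<open>n \<noteq> 0\<close> by (cases n) (auto simp: coeff_pderiv)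
  qed
  \<comment> \<open>\<open>N\<close> is closed, so a neighbourhood of \<open>b\<close> of radius \<open>v z\<close> misses \<open>N\<close>.\<close>
  have "b \<notin> valuation_closure v N" using b by (simp add: N_def valuation_closure_idem)
  then obtain z where z: "z \<noteq> 0" "\<And>y. y \<in> N \<Longrightarrow> \<not> v z \<le> v (b - y)"
    by (auto simp: valuation_closure_def)
  \<comment> \<open>\<open>v d\<close> is the precision to which the coefficients of \<open>f\<close> have to be approximated.\<close>
  obtain d where d: "d \<noteq> 0" and near: "\<And>g. degree g \<le> n \<Longrightarrow> (\<forall>i. v d \<le> v (coeff (g - f) i)) \<Longrightarrow>
           \<exists>x. poly g x = 0 \<and> v z \<le> v (x - b)"
    using henselian_root_near[OF hens f(4) sep z(1) w] f(3) by auto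
  have "\<exists>c\<in>K. v d \<le> v (coeff f i - c)" for i
    using valuation_closure_approx[OF _ d] coeff_in[OF f(1)] N_def by metis
  then obtain c where c: "\<And>i. c i \<in> K" "\<And>i. v d \<le> v (coeff f i - c i)" by metis
  define g where "g = monom 1 n + (\<Sum>i<n. monom (c i) i)"
  have coeff_g: "coeff g i = (if i = n then 1 else if i < n then c i else 0)" for i
    by (auto simp: g_def coeff_sum)
  have deg_g: "degree g = n"
    by (intro antisym degree_le le_degree) (auto simp: coeff_g)
  have g: "g \<in> polys_over K" "lead_coeff g = 1"
    using c(1) sub_0[OF K] sub_1[OF K] by (auto simp: polys_over_def coeff_g deg_g)
  have "v d \<le> v (coeff (g - f) i)" for i
    using c(2)[of i] f(2,3) v_diff_commute[of "c i" "coeff f i"] by (auto simp: coeff_g coeff_eq_0)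
  then obtain x where x: "poly g x = 0" "v z \<le> v (x - b)"
    using near[of g] deg_g by auto
  have "x \<notin> N" using z(2)[of x] x(2) by (auto simp: v_diff_commute)
  then have "a \<in> adjoin K x" using max KN by blast
  then obtain p0 q0 where pq0: "p0 \<in> polys_over K" "q0 \<in> polys_over K" "a = poly p0 x / poly q0 x"
    by (auto simp: adjoin_def)
  have q0x: "poly q0 x \<noteq> 0" using a(1) pq0(3) sub_0[OF K] by auto
  obtain p q where p: "p \<in> polys_over K" "degree p < n" "poly p x = poly p0 x"
    and q: "q \<in> polys_over K" "degree q < n" "poly q x = poly q0 x"
    using remainder_at_root[OF K g, of x] deg_g \<open>n \<noteq> 0\<close> x(1) pq0(1,2) by (metis gr0I)
  \<comment> \<open>As \<open>x \<notin> N\<close>, its degree over \<open>N\<close> is at least \<open>n\<close>, which excludes non-trivial relations.\<close>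
  have "p - smult a q = 0"
  proof (rule minimal[OF \<open>x \<notin> N\<close>])
    have "p \<in> polys_over N" "q \<in> polys_over N" using p(1) q(1) polys_over_mono[OF KN] by auto
    then show "p - smult a q \<in> polys_over N"
      using a(2) by (intro over_diff[OF N] over_smult[OF N]) (auto simp: N_def)
    show "poly (p - smult a q) x = 0" using pq0(3) p(3) q(3) q0x by simp
    show "degree (p - smult a q) < n"
      using p(2) q(2) by (intro degree_diff_less) (auto intro: le_less_trans[OF degree_smult_le])
  qed
  moreover obtain i where "coeff q i \<noteq> 0"
    using q(3) q0x by (metis leading_coeff_0_iff poly_0)
  ultimately have "a = coeff p i / coeff q i" by (simp add: field_simps)
  then show False using a(1) sub_divide[OF K coeff_in[OF p(1)] coeff_in[OF q(1)]] by blast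
qed

lemma exists_dense_subfield_if_seed:
  assumes hens: "henselian v" and char_0: "\<And>n. n > 0 \<Longrightarrow> of_nat n \<noteq> (0::'a)"
    and w: "w \<noteq> 0" "0 < v w"
    and K0: "is_subfield K0" "a \<notin> K0" "a \<in> valuation_closure v K0"
  shows "\<exists>K. is_subfield K \<and> K \<noteq> UNIV \<and> valuation_closure v K = UNIV \<and> (\<forall>x. algebraic_over K x)"
proof -
  obtain K where K: "is_subfield K" "K0 \<subseteq> K" "a \<notin> K" and max: "\<And>x. x \<notin> K \<Longrightarrow> a \<in> adjoin K x"
    using exists_maximal_subfield_avoiding[OF K0(1,2)] by blast
  have "inj (of_nat :: nat \<Rightarrow> 'a)"
  proof (rule injI)
    have *: "m = n" if "m \<le> n" "of_nat m = (of_nat n :: 'a)" for m n :: nat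
      using that char_0[of "n - m"] by (cases "n - m = 0") (auto simp: of_nat_diff)
    show "m = n" if "of_nat m = (of_nat n :: 'a)" for m n :: nat
      using *[of m n] *[of n m] that by (metis linorder_class.linear)
  qed
  then have inf: "infinite K"
    using sub_of_nat[OF K(1)] by (metis finite_subset image_subsetI infinite_UNIV_nat finite_imageD)
  have "algebraic_over K a"
    using max[of "a ^ 2 + a"] algebraic_over_if_in_adjoin_square_plus_self[OF K(1)]
  proof (cases "a ^ 2 + a \<in> K")
    case True
    have "[:- (a ^ 2 + a), 1, 1:] \<in> polys_over K"
      using sub_minus[OF K(1) True] over_0[OF K(1)] sub_1[OF K(1)]
      by (simp only: over_pCons[OF K(1)] simp_thms)
    then show ?thesis
      by (auto simp: algebraic_over_def power2_eq_square algebra_simps intro!: bexI[of _ "[:- (a ^ 2 + a), 1, 1:]"])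
  qed auto
  then have alg: "algebraic_over K x" for x
    using algebraic_over_if_algebraic_in_adjoin[OF K(1) inf max _] K(3)
      algebraic_over_self[OF K(1), of x] by blast
  have "a \<in> valuation_closure v K" using K0(3) valuation_closure_mono[OF K(2)] by blast
  then have "valuation_closure v K = UNIV"
    using maximal_subfield_dense[OF hens char_0 w K(1) alg K(3) _ max] by blast
  then show ?thesis using K alg by blast
qed

end


section \<open>Transcendental elements of dominating value\<close>

lemma adjoin_subset:
  assumes "is_subfield M" "K \<subseteq> M" "x \<in> M"
  shows "adjoin K x \<subseteq> M"
  using polys_over_mono[OF assms(2)]
  by (auto simp: adjoin_def assms(3) intro!: sub_divide[OF assms(1)] poly_in[OF assms(1)])

lemma common_denominator:
  fixes n :: nat
  assumes F: "is_subfield F" and c: "\<And>i. i \<le> n \<Longrightarrow> c i \<in> adjoin F y"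
  shows "\<exists>q\<in>polys_over F. poly q y \<noteq> 0 \<and> (\<forall>i\<le>n. \<exists>r\<in>polys_over F. c i * poly q y = poly r y)"
  using c
proof (induction n)
  case 0
  then obtain p q where *: "p \<in> polys_over F" "q \<in> polys_over F" "c 0 = poly p y / poly q y"
    by (auto simp: adjoin_def)
  show ?case
  proof (cases "poly q y = 0")
    case True
    then show ?thesis using * over_1[OF F] over_0[OF F] by (intro bexI[of _ 1]) (auto intro!: bexI[of _ 0])
  next
    case False
    then show ?thesis using * by (intro bexI[of _ q]) auto
  qed
next
  case (Suc n)
  then obtain q where q: "q \<in> polys_over F" "poly q y \<noteq> 0"
    "\<And>i. i \<le> n \<Longrightarrow> \<exists>r\<in>polys_over F. c i * poly q y = poly r y"
    by (meson le_Suc_eq)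
  obtain p s where *: "p \<in> polys_over F" "s \<in> polys_over F" "c (Suc n) = poly p y / poly s y"
    using Suc.prems[of "Suc n"] by (auto simp: adjoin_def)
  show ?case
  proof (cases "poly s y = 0")
    case True
    have "\<exists>r\<in>polys_over F. c i * poly q y = poly r y" if "i \<le> Suc n" for i
      using q(3)[of i] that True * over_0[OF F] by (cases "i = Suc n") (auto intro: bexI[of _ 0])
    then show ?thesis using q(1,2) by blast
  next
    case False
    have "\<exists>r\<in>polys_over F. c i * poly (q * s) y = poly r y" if i: "i \<le> Suc n" for i
    proof (cases "i = Suc n")
      case True
      then show ?thesis using * q(1) False over_mult[OF F]
        by (intro bexI[of _ "p * q"]) auto
    next
      case False
      then obtain r where "r \<in> polys_over F" "c i * poly q y = poly r y"
        using q(3)[of i] i by auto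
      then show ?thesis using *(2) over_mult[OF F]
        by (intro bexI[of _ "r * s"]) (auto simp: mult.assoc[symmetric])
    qed
    then show ?thesis using q(1,2) *(2) False over_mult[OF F] by (intro bexI[of _ "q * s"]) auto
  qed
qed

text \<open>
  The exchange property of algebraic dependence. A relation between \<open>a\<close> and \<open>y\<close> over \<open>F\<close>, which is
  non-trivial as a polynomial in \<open>a\<close>, is read as a polynomial in \<open>y\<close>. It remains non-trivial, as the
  transcendental element \<open>a\<close> annihilates no non-zero polynomial over \<open>F\<close>.
\<close>

lemma algebraic_exchange:
  assumes F: "is_subfield F" and a: "\<not> algebraic_over F a" "algebraic_over (adjoin F y) a"
  shows "algebraic_over (adjoin F a) y"
proof -
  obtain p where p: "p \<in> polys_over (adjoin F y)" "p \<noteq> 0" "poly p a = 0"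
    using a(2) by (auto simp: algebraic_over_def)
  define n where "n = degree p"
  obtain q where q: "q \<in> polys_over F" "poly q y \<noteq> 0"
    and ex: "\<And>i. i \<le> n \<Longrightarrow> \<exists>r\<in>polys_over F. coeff p i * poly q y = poly r y"
    using common_denominator[OF F, of n "coeff p" y] coeff_in[OF p(1)] by blast
  obtain r where r: "\<And>i. i \<le> n \<Longrightarrow> r i \<in> polys_over F"
    "\<And>i. i \<le> n \<Longrightarrow> coeff p i * poly q y = poly (r i) y"
    using ex by metis
  have "poly (r n) y \<noteq> 0"
    using r(2)[of n] q(2) p(2) by (auto simp: n_def)
  then obtain j where j: "coeff (r n) j \<noteq> 0"
    by (metis leading_coeff_0_iff poly_0)
  \<comment> \<open>The relation \<open>\<Sum> r\<^sub>i(y) a\<^sup>i = 0\<close>, read as a polynomial in \<open>y\<close> over \<open>F[a]\<close>.\<close>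
  define Q where "Q = (\<Sum>i\<le>n. smult (a ^ i) (r i))"
  define s where "s = (\<Sum>i\<le>n. monom (coeff (r i) j) i)"
  have coeff_s: "coeff s i = (if i \<le> n then coeff (r i) j else 0)" for i
    by (auto simp: s_def coeff_sum)
  have "s \<in> polys_over F"
    using coeff_in[OF r(1)] sub_0[OF F] by (auto simp: polys_over_def coeff_s)
  moreover have "s \<noteq> 0" using coeff_s[of n] j by auto
  ultimately have "poly s a \<noteq> 0" using a(1) by (auto simp: algebraic_over_def)
  moreover have "coeff Q j = poly s a"
    by (simp add: Q_def s_def coeff_sum poly_sum poly_monom mult.commute)
  ultimately have "Q \<noteq> 0" by auto
  note A = is_subfield_adjoin[OF F, of a]
  have "Q \<in> polys_over (adjoin F a)"
    unfolding Q_def using r(1) polys_over_mono[OF subset_adjoin[OF F]] generator_in_adjoin[OF F]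
    by (intro over_sum[OF A] over_smult[OF A] sub_power[OF A]) auto
  moreover have "poly Q y = 0"
  proof -
    have "poly Q y = (\<Sum>i\<le>n. poly q y * (coeff p i * a ^ i))"
      unfolding Q_def poly_sum
    proof (rule sum.cong)
      show "poly (smult (a ^ i) (r i)) y = poly q y * (coeff p i * a ^ i)" if "i \<in> {..n}" for i
        using that by (simp add: r(2)[symmetric])
    qed simp
    then show ?thesis
      using p(3) by (simp add: sum_distrib_left[symmetric] poly_altdef[of p] n_def)
  qed
  ultimately show ?thesis using \<open>Q \<noteq> 0\<close> by (auto simp: algebraic_over_def)
qed

context krull_valuation
begin

text \<open>
  For \<open>x\<close> of positive value: the archimedean class of \<open>v x\<close> is less than that of \<open>v y\<close>.
\<close>

definition infinitely_below :: "'a \<Rightarrow> 'a \<Rightarrow> bool"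
  where "infinitely_below x y \<longleftrightarrow> (\<forall>n. v (x ^ n) < v y)"

text \<open>
  For a subfield \<open>F\<close> this bounds the values of \<open>F\<close> on both sides, and says that \<open>v t\<close> exceeds the convex
  subgroup generated by them, because \<open>F\<close> is closed under powers and inverses.
\<close>

definition dominated :: "'a set \<Rightarrow> 'a \<Rightarrow> bool"
  where "dominated F t \<longleftrightarrow> (\<forall>x\<in>F. x \<noteq> 0 \<longrightarrow> v x < v t)"

lemma infinitely_below_less: "infinitely_below x y \<Longrightarrow> v x < v y"
  by (metis infinitely_below_def power_one_right)

lemma infinitely_below_mono: "v x \<le> v y \<Longrightarrow> infinitely_below y z \<Longrightarrow> infinitely_below x z"
  unfolding infinitely_below_def using v_power_mono le_less_trans by blast

text \<open>
  In \<open>p(t) = c\<^sub>k t\<^sup>k + c\<^sub>k\<^sub>+\<^sub>1 t\<^sup>k\<^sup>+\<^sup>1 + \<dots>\<close> the first non-zero term has the least value, since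
  quotients of coefficients have values below \<open>v t\<close>.
\<close>

lemma value_of_poly_at_dominating:
  assumes F: "is_subfield F" "dominated F t" and t: "t \<noteq> 0" and p: "p \<in> polys_over F" "p \<noteq> 0"
  shows "\<exists>x\<in>F. \<exists>k. x \<noteq> 0 \<and> v (poly p t) = v (x * t ^ k)"
proof -
  have t_pos: "0 < v t"
    using F(2) sub_1[OF F(1)] unfolding dominated_def by (metis one_neq_zero v_1)
  have tail: "v x < v (t * poly r t)" if x: "x \<in> F" "x \<noteq> 0" and r: "r \<in> polys_over F" for x r
    using r
  proof (induction r)
    case 0
    then show ?case using v_nonzero_Fin[OF x(2)] by auto
  next
    case (pCons c r)
    then have c: "c \<in> F" and IH: "v x < v (t * poly r t)"
      by (auto simp: over_pCons[OF F(1)])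
    have "v x < v (t * c)"
    proof (cases "c = 0")
      case False
      have "v (x / c) < v t"
        using F(2) x c False sub_divide[OF F(1)] by (auto simp: dominated_def)
      then show ?thesis
        using v_mult_less_iff[OF False, of "x / c" t] False by (simp add: mult.commute)
    qed (use v_nonzero_Fin[OF x(2)] in auto)
    moreover have "v x < v (t * (t * poly r t))"
      using IH v_le_mult[of t "t * poly r t"] t_pos
      by (auto simp: mult.commute intro: less_le_trans)
    ultimately show ?case by (simp add: distrib_left v_add_gt)
  qed
  show ?thesis using p
  proof (induction p)
    case (pCons c p)
    then have c: "c \<in> F" and p: "p \<in> polys_over F" by (auto simp: over_pCons[OF F(1)])
    show ?case
    proof (cases "c = 0")
      case True
      then have "p \<noteq> 0" using pCons.prems by auto
      then obtain x k where "x \<in> F" "x \<noteq> 0" "v (poly p t) = v (x * t ^ k)"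
        using pCons.IH p by blast
      then show ?thesis
        using True by (intro bexI[of _ x] exI[of _ "Suc k"]) (auto simp: val_mult ac_simps)
    next
      case False
      then have "v (c + t * poly p t) = v c" using tail[OF c False p] by (rule_tac v_add_eq)
      then show ?thesis using c False by (intro bexI[of _ c] exI[of _ 0]) auto
    qed
  qed simp
qed

lemma transcendental_if_dominating:
  assumes "is_subfield F" "dominated F t" "t \<noteq> 0"
  shows "\<not> algebraic_over F t"
proof
  assume "algebraic_over F t"
  then obtain p where p: "p \<in> polys_over F" "p \<noteq> 0" "poly p t = 0"
    by (auto simp: algebraic_over_def)
  obtain x k where "x \<noteq> 0" "v (poly p t) = v (x * t ^ k)"
    using value_of_poly_at_dominating[OF assms p(1,2)] by blast
  then have "x * t ^ k = 0" using p(3) eq_Pinf_iff[of "x * t ^ k"] by simp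
  then show False using \<open>x \<noteq> 0\<close> assms(3) by simp
qed

lemma dominated_adjoin:
  assumes F: "is_subfield F" "dominated F t" "t \<noteq> 0" and s: "infinitely_below t s"
  shows "dominated (adjoin F t) s"
  unfolding dominated_def
proof (intro ballI impI)
  fix z assume "z \<in> adjoin F t" "z \<noteq> 0"
  then obtain p q where pq: "p \<in> polys_over F" "q \<in> polys_over F" "z = poly p t / poly q t"
    "poly p t \<noteq> 0" "poly q t \<noteq> 0"
    by (auto simp: adjoin_def)
  then have "p \<noteq> 0" "q \<noteq> 0" by auto
  then obtain x k y l where x: "x \<in> F" "x \<noteq> 0" "v (poly p t) = v (x * t ^ k)"
    and y: "y \<in> F" "y \<noteq> 0" "v (poly q t) = v (y * t ^ l)"
    using value_of_poly_at_dominating[OF F pq(1)] value_of_poly_at_dominating[OF F pq(2)] by metis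
  have "0 < v t"
    using F(2) sub_1[OF F(1)] unfolding dominated_def by (metis one_neq_zero v_1)
  then have "v z \<le> v (z * t ^ l)"
    by (intro v_le_mult v_power_nonneg less_imp_le)
  also have "v (z * t ^ l) = v (x / y * t ^ k)"
  proof -
    have "v (y * (z * t ^ l)) = v (z * poly q t)" using y(3) by (simp add: val_mult ac_simps)
    also have "\<dots> = v (y * (x / y * t ^ k))" using pq(3,5) x(3) y(2) by simp
    finally show ?thesis using v_mult_le_iff[OF y(2)] by (metis order_antisym order_refl)
  qed
  also have "\<dots> < v (t * t ^ k)"
  proof -
    have "v (x / y) < v t"
      using F(2) sub_divide[OF F(1) x(1) y(1)] x(2) y(2) by (auto simp: dominated_def)
    then show ?thesis
      using v_mult_less_iff[of "t ^ k" "x / y" t] F(3) by (simp add: mult.commute)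
  qed
  also have "\<dots> < v s" using s[unfolded infinitely_below_def, rule_format, of "Suc k"] by simp
  finally show "v z < v s" .
qed

section \<open>Two constructions of a seed\<close>

text \<open>
  With \<open>t = a\<^sup>2 + a\<close>, the map \<open>b \<mapsto> t - b\<^sup>2\<close> preserves \<open>P(t)\<close> and fixes \<open>a\<close>. It is a contraction near \<open>a\<close>:
  \<open>a - (t - b\<^sup>2) = - (a - b) (a + b)\<close> and \<open>v (a + b) \<ge> v a\<close>.
\<close>

lemma seed_if_powers_cofinal:
  assumes P: "is_subfield P" "\<And>x. x \<in> P \<Longrightarrow> x \<noteq> 0 \<Longrightarrow> v x = 0"
    and a: "a \<noteq> 0" "0 < v a" and cofinal: "\<And>z. z \<noteq> 0 \<Longrightarrow> \<exists>n. v z \<le> v (a ^ n)"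
  shows "\<exists>K. is_subfield K \<and> a \<notin> K \<and> a \<in> valuation_closure v K"
proof (intro exI conjI)
  define K where "K = adjoin P (a ^ 2 + a)"
  show K: "is_subfield K" unfolding K_def by (rule is_subfield_adjoin[OF P(1)])
  \<comment> \<open>\<open>P\<close> is trivially valued, so \<open>a\<close> dominates it and is transcendental.\<close>
  have "dominated P a" using P(2) a(2) by (simp add: dominated_def)
  then show "a \<notin> K"
    using transcendental_if_dominating[OF P(1) _ a(1)]
      algebraic_over_if_in_adjoin_square_plus_self[OF P(1)] K_def by blast
  have approx: "\<exists>b\<in>K. v (a * a ^ n) \<le> v (a - b)" for n
  proof (induction n)
    case 0
    show ?case using sub_0[OF K] by (intro bexI[of _ 0]) auto
  next
    case (Suc n)
    then obtain b where b: "b \<in> K" "v (a * a ^ n) \<le> v (a - b)" by blast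
    have "v a \<le> v (a * a ^ n)" using a(2) by (intro v_le_mult v_power_nonneg) simp
    then have "v a \<le> v (a - b)" using b(2) by simp
    then have "v a \<le> v (- (a - b) + (a + a))"
      by (intro v_add_ge) (simp_all only: v_minus order_refl)
    then have "v a \<le> v (b + a)" by (simp add: algebra_simps)
    then have "v ((a * a ^ n) * a) \<le> v ((a - b) * - (b + a))"
      using b(2) v_minus[of "b + a"] by (intro v_mult_mono) simp_all
    moreover have "(a - b) * - (b + a) = a - (a ^ 2 + a - b ^ 2)"
      by (simp add: power2_eq_square algebra_simps)
    moreover have "a ^ 2 + a - b ^ 2 \<in> K"
      using b(1) generator_in_adjoin[OF P(1)] sub_diff[OF K] sub_power[OF K] by (simp add: K_def)
    ultimately show ?case by (intro bexI[of _ "a ^ 2 + a - b ^ 2"]) (simp_all add: mult_ac)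
  qed
  have le: "v (a ^ n) \<le> v (a * a ^ n)" for n
    using v_le_mult[of a "a ^ n"] a(2) by (simp add: mult.commute)
  show "a \<in> valuation_closure v K"
    unfolding valuation_closure_def
  proof (intro CollectI allI impI)
    fix z :: 'a assume "z \<noteq> 0"
    then obtain n where "v z \<le> v (a ^ n)" using cofinal by blast
    also note le[of n]
    finally have "v z \<le> v (a * a ^ n)" .
    moreover obtain b where "b \<in> K" "v (a * a ^ n) \<le> v (a - b)" using approx by blast
    ultimately show "\<exists>b\<in>K. v z \<le> v (a - b)" by (meson order_trans)
  qed
qed

text \<open>
  The field \<open>F\<close> is obtained by adjoining the elements \<open>a + t\<close> in the order of increasing \<open>v t\<close>. In each
  step the new \<open>x\<close> dominates \<open>F(a)\<close>, so \<open>a + x\<close> is transcendental over \<open>F(a)\<close>, and by exchange \<open>a\<close> is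
  transcendental over \<open>F(a + x)\<close>. The last part of the claim keeps the induction going.
\<close>

lemma transcendental_over_perturbations:
  assumes P: "is_subfield P" "\<And>x. x \<in> P \<Longrightarrow> x \<noteq> 0 \<Longrightarrow> v x = 0" and a: "a \<noteq> 0" "0 < v a"
    and S: "finite S" "\<And>t. t \<in> S \<Longrightarrow> t \<noteq> 0 \<and> infinitely_below a t"
      "\<And>s t. s \<in> S \<Longrightarrow> t \<in> S \<Longrightarrow> s \<noteq> t \<Longrightarrow> infinitely_below s t \<or> infinitely_below t s"
  shows "\<exists>F. is_subfield F \<and> (\<forall>t\<in>S. a + t \<in> F) \<and> \<not> algebraic_over F a \<and>
           (\<forall>s. infinitely_below a s \<longrightarrow> (\<forall>t\<in>S. infinitely_below t s) \<longrightarrow> dominated (adjoin F a) s)"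
  using S
proof (induction S rule: finite_ranking_induct[where f = v])
  case empty
  have "dominated P a" using P(2) a(2) by (simp add: dominated_def)
  then show ?case
    using transcendental_if_dominating[OF P(1) _ a(1)] dominated_adjoin[OF P(1) _ a(1)] P(1)
    by (intro exI[of _ P]) auto
next
  case (insert x S)
  obtain F where F: "is_subfield F" "\<And>t. t \<in> S \<Longrightarrow> a + t \<in> F" "\<not> algebraic_over F a"
    and dom: "\<And>s. infinitely_below a s \<Longrightarrow> \<forall>t\<in>S. infinitely_below t s \<Longrightarrow> dominated (adjoin F a) s"
    using insert.IH insert.prems by (metis insertCI)
  show ?case
  proof (cases "x \<in> S")
    case True
    then show ?thesis using F dom by (metis insert_absorb)
  next
    case False
    have x: "x \<noteq> 0" "infinitely_below a x" using insert.prems(1) by auto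
    have "infinitely_below t x" if "t \<in> S" for t
    proof -
      have "x \<noteq> t" using that False by blast
      moreover have "\<not> infinitely_below x t"
        using insert.hyps(2)[OF that] infinitely_below_less[of x t] by auto
      ultimately show ?thesis using insert.prems(2)[of x t] that by blast
    qed
    then have dom_x: "dominated (adjoin F a) x" using dom x(2) by blast
    note E = is_subfield_adjoin[OF F(1), of a] and F' = is_subfield_adjoin[OF F(1), of "a + x"]
    have tr: "\<not> algebraic_over (adjoin F a) (a + x)"
    proof
      assume "algebraic_over (adjoin F a) (a + x)"
      then obtain p where p: "p \<in> polys_over (adjoin F a)" "p \<noteq> 0" "poly p (a + x) = 0"
        by (auto simp: algebraic_over_def)
      have "[:a, 1:] \<in> polys_over (adjoin F a)"
        using generator_in_adjoin[OF F(1)] by (simp add: over_pCons[OF E] over_0[OF E] sub_1[OF E])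
      then have "pcompose p [:a, 1:] \<in> polys_over (adjoin F a)" using p(1) by (rule_tac over_pcompose[OF E])
      moreover have "pcompose p [:a, 1:] \<noteq> 0" using p(2) pcompose_eq_0[of p "[:a, 1:]"] by auto
      moreover have "poly (pcompose p [:a, 1:]) x = 0" using p(3) by (simp add: poly_pcompose)
      ultimately show False
        using transcendental_if_dominating[OF E dom_x x(1)] by (auto simp: algebraic_over_def)
    qed
    show ?thesis
    proof (intro exI[of _ "adjoin F (a + x)"] conjI allI impI)
      show "is_subfield (adjoin F (a + x))" by (rule F')
      show "\<forall>t\<in>insert x S. a + t \<in> adjoin F (a + x)"
        using F(2) subset_adjoin[OF F(1)] generator_in_adjoin[OF F(1)] by blast
      show "\<not> algebraic_over (adjoin F (a + x)) a"
        using algebraic_exchange[OF F(1,3)] tr by blast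
      fix s assume "infinitely_below a s" "\<forall>t\<in>insert x S. infinitely_below t s"
      then have "dominated (adjoin (adjoin F a) x) s"
        using dominated_adjoin[OF E dom_x x(1)] by blast
      moreover have "adjoin (adjoin F (a + x)) a \<subseteq> adjoin (adjoin F a) x"
      proof -
        note EE = is_subfield_adjoin[OF E, of x]
        have a_in: "a \<in> adjoin (adjoin F a) x"
          using generator_in_adjoin[OF F(1)] subset_adjoin[OF E] by blast
        have x_in: "x \<in> adjoin (adjoin F a) x" using generator_in_adjoin[OF E] .
        show ?thesis
          using subset_adjoin[OF F(1), of a] subset_adjoin[OF E, of x] a_in sub_add[OF EE a_in x_in]
          by (intro adjoin_subset[OF EE]) auto
      qed
      ultimately show "dominated (adjoin (adjoin F (a + x)) a) s" by (auto simp: dominated_def)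
    qed
  qed
qed

text \<open>
  A maximal chain \<open>T\<close> of archimedean classes above \<open>a\<close> has cofinal values, since otherwise it could be
  continued. Thus the elements \<open>a + t\<close> approximate \<open>a\<close>. Each element of the field they generate involves
  only finitely many of them, so that \<open>a\<close> is not in it by the independence just shown.
\<close>

lemma seed_if_no_powers_cofinal:
  assumes P: "is_subfield P" "\<And>x. x \<in> P \<Longrightarrow> x \<noteq> 0 \<Longrightarrow> v x = 0" and a: "a \<noteq> 0" "0 < v a"
    and not_cofinal: "\<And>x. x \<noteq> 0 \<Longrightarrow> 0 < v x \<Longrightarrow> \<exists>z. z \<noteq> 0 \<and> infinitely_below x z"
  shows "\<exists>K. is_subfield K \<and> a \<notin> K \<and> a \<in> valuation_closure v K"
proof -
  define \<T> where "\<T> = {T. (\<forall>t\<in>T. t \<noteq> 0 \<and> infinitely_below a t) \<and>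
    (\<forall>s\<in>T. \<forall>t\<in>T. s \<noteq> t \<longrightarrow> infinitely_below s t \<or> infinitely_below t s)}"
  have "\<exists>M\<in>\<T>. \<forall>Y\<in>\<T>. M \<subseteq> Y \<longrightarrow> Y = M"
  proof (rule subset_Zorn_nonempty)
    show "\<T> \<noteq> {}" by (auto simp: \<T>_def)
    fix \<C> assume chain: "subset.chain \<T> \<C>"
    have "infinitely_below s t \<or> infinitely_below t s"
      if st: "S \<in> \<C>" "T \<in> \<C>" "s \<in> S" "t \<in> T" "s \<noteq> t" for S T s t
    proof -
      have "S \<subseteq> T \<or> T \<subseteq> S" using chain st(1,2) by (auto simp: subset.chain_def)
      then obtain U where "U \<in> \<C>" "s \<in> U" "t \<in> U" using st(1-4) by (metis subsetD)
      then show ?thesis using chain st(5) by (auto simp: subset.chain_def \<T>_def)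
    qed
    then show "\<Union>\<C> \<in> \<T>" using chain by (fastforce simp: subset.chain_def \<T>_def)
  qed
  then obtain T where "T \<in> \<T>" and max: "\<And>Y. Y \<in> \<T> \<Longrightarrow> T \<subseteq> Y \<Longrightarrow> Y = T" by blast
  then have T: "\<And>t. t \<in> T \<Longrightarrow> t \<noteq> 0 \<and> infinitely_below a t"
    "\<And>s t. s \<in> T \<Longrightarrow> t \<in> T \<Longrightarrow> s \<noteq> t \<Longrightarrow> infinitely_below s t \<or> infinitely_below t s"
    by (auto simp: \<T>_def)
  \<comment> \<open>Beyond an upper bound of \<open>T\<close> there is a further archimedean class, against maximality.\<close>
  have cofinal: "\<exists>t\<in>T. v z \<le> v t" if z: "z \<noteq> 0" for z
  proof (rule ccontr)
    assume "\<not> (\<exists>t\<in>T. v z \<le> v t)"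
    then have less: "\<And>t. t \<in> T \<Longrightarrow> v t < v z" by (auto simp: not_le)
    obtain y where y: "y \<noteq> 0" "v a \<le> v y" "v z \<le> v y"
      using linorder_class.linear[of "v a" "v z"] z a(1) by (metis order_refl)
    then obtain s where s: "s \<noteq> 0" "infinitely_below y s"
      using not_cofinal[of y] less_le_trans[OF a(2) y(2)] by blast
    have "infinitely_below a s" using infinitely_below_mono[OF y(2) s(2)] .
    moreover have below: "infinitely_below t s" if "t \<in> T" for t
      using infinitely_below_mono[OF _ s(2), of t] less[OF that] y(3) by auto
    ultimately have "insert s T \<in> \<T>" using T s(1) by (auto simp: \<T>_def)
    then have "s \<in> T" using max by blast
    then show False using infinitely_below_less[OF below] by blast
  qed
  \<comment> \<open>The subfield generated by all \<open>a + t\<close>; each element is accounted for by finitely many of them.\<close>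
  define K where "K = {x. \<exists>S. finite S \<and> S \<subseteq> T \<and>
    (\<forall>F. is_subfield F \<longrightarrow> (\<forall>t\<in>S. a + t \<in> F) \<longrightarrow> x \<in> F)}"
  have "is_subfield K"
    unfolding is_subfield_def
  proof (intro conjI ballI)
    show "1 \<in> K" using sub_1 by (auto simp: K_def)
  next
    fix x y assume "x \<in> K" "y \<in> K"
    then obtain S R where S: "finite S" "S \<subseteq> T" "\<And>F. is_subfield F \<Longrightarrow> (\<forall>t\<in>S. a + t \<in> F) \<Longrightarrow> x \<in> F"
      and R: "finite R" "R \<subseteq> T" "\<And>F. is_subfield F \<Longrightarrow> (\<forall>t\<in>R. a + t \<in> F) \<Longrightarrow> y \<in> F"
      by (auto simp: K_def)
    have "finite (S \<union> R)" "S \<union> R \<subseteq> T" using S(1,2) R(1,2) by auto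
    moreover have "x - y \<in> F" "x * y \<in> F"
      if F: "is_subfield F" "\<forall>t\<in>S \<union> R. a + t \<in> F" for F
      using S(3)[OF F(1)] R(3)[OF F(1)] F(2) sub_diff[OF F(1)] sub_mult[OF F(1)] by auto
    ultimately show "x - y \<in> K" "x * y \<in> K" unfolding K_def by blast+
  next
    fix x assume "x \<in> K"
    then obtain S where S: "finite S" "S \<subseteq> T"
      "\<And>F. is_subfield F \<Longrightarrow> (\<forall>t\<in>S. a + t \<in> F) \<Longrightarrow> x \<in> F"
      by (auto simp: K_def)
    have "inverse x \<in> F" if F: "is_subfield F" "\<forall>t\<in>S. a + t \<in> F" for F
      using sub_inverse[OF F(1) S(3)[OF F]] .
    then show "inverse x \<in> K" unfolding K_def using S(1,2) by blast
  qed
  moreover have "a \<notin> K"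
  proof
    assume "a \<in> K"
    then obtain S where S: "finite S" "S \<subseteq> T"
      "\<And>F. is_subfield F \<Longrightarrow> (\<forall>t\<in>S. a + t \<in> F) \<Longrightarrow> a \<in> F"
      by (auto simp: K_def)
    have "\<exists>F. is_subfield F \<and> (\<forall>t\<in>S. a + t \<in> F) \<and> \<not> algebraic_over F a \<and>
        (\<forall>s. infinitely_below a s \<longrightarrow> (\<forall>t\<in>S. infinitely_below t s) \<longrightarrow> dominated (adjoin F a) s)"
    proof (rule transcendental_over_perturbations[OF P a S(1)])
      show "t \<noteq> 0 \<and> infinitely_below a t" if "t \<in> S" for t
        using T(1) S(2) that by blast
      show "infinitely_below s t \<or> infinitely_below t s" if "s \<in> S" "t \<in> S" "s \<noteq> t" for s t
        using T(2) S(2) that by blast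
    qed
    then obtain F where F: "is_subfield F" "\<forall>t\<in>S. a + t \<in> F" "\<not> algebraic_over F a"
      by (elim exE conjE)
    then show False using algebraic_over_self[OF F(1) S(3)[OF F(1,2)]] by blast
  qed
  moreover have "a \<in> valuation_closure v K"
    unfolding valuation_closure_def
  proof (intro CollectI allI impI)
    fix z :: 'a assume "z \<noteq> 0"
    then obtain t where t: "t \<in> T" "v z \<le> v t" using cofinal by blast
    have "a + t \<in> K" unfolding K_def using t(1) by (intro CollectI exI[of _ "{t}"]) auto
    then show "\<exists>b\<in>K. v z \<le> v (a - b)" using t(2) by (intro bexI[of _ "a + t"]) auto
  qed
  ultimately show ?thesis by blast
qed

section \<open>Residue characteristic zero\<close>

lemma v_of_nat_nonneg: "0 \<le> v (of_nat n)"
  by (induction n) (auto intro: v_add_ge)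

text \<open>
  If \<open>n\<close> had positive value, then \<open>n \<cdot> 1\<close> would vanish in the residue field, and the additive order of
  \<open>1\<close> would be a divisor of \<open>n\<close>. The multiple \<open>k \<cdot> 1\<close> is computed as the coset of \<open>k\<close>.
\<close>

lemma v_of_nat:
  assumes char: "ring_characteristic (residue_field v) = 0" and n: "n > 0"
  shows "v (of_nat n) = 0"
proof (rule ccontr)
  assume "v (of_nat n) \<noteq> 0"
  then have pos: "0 < v (of_nat n)" using v_of_nat_nonneg[of n] by auto
  let ?A = "valuation_ring v" and ?I = "valuation_ideal v"
  interpret L: field "ring_of_type_algebra :: 'a ring" by (rule field_from_type_algebra)
  have a_inv: "\<ominus>\<^bsub>ring_of_type_algebra\<^esub> x = - x" for x :: 'a
    by (rule L.minus_equality) (auto simp: ring_of_type_algebra_def)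
  have "subring {x. 0 \<le> v x} ring_of_type_algebra"
    by (rule L.subringI, unfold a_inv)
      (auto simp: ring_of_type_algebra_def intro: v_add_ge v_mult_nonneg)
  then interpret A: ring ?A
    unfolding valuation_ring_def by (rule L.subring_is_ring)
  have A_simps: "carrier ?A = {x. 0 \<le> v x}" "x \<oplus>\<^bsub>?A\<^esub> y = x + y" "x \<otimes>\<^bsub>?A\<^esub> y = x * y"
    "\<one>\<^bsub>?A\<^esub> = 1" "\<zero>\<^bsub>?A\<^esub> = 0" for x y
    by (simp_all add: valuation_ring_def ring_of_type_algebra_def)
  have A_inv: "\<ominus>\<^bsub>?A\<^esub> x = - x" if "0 \<le> v x" for x
    using that by (intro A.minus_equality) (auto simp: A_simps)
  have small_mult: "0 < v (x * y)" if "0 < v x" "0 \<le> v y" for x y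
    using that v_le_mult[of y x] by simp
  have v_0_pos: "0 < v 0" by (simp add: zero_extended_def)
  interpret I: ideal ?I ?A
  proof (rule idealI)
    show "ring ?A" by (rule A.ring_axioms)
    show "subgroup ?I (add_monoid ?A)"
    proof (rule A.add.subgroupI)
      show "\<ominus>\<^bsub>?A\<^esub> x \<in> ?I" if "x \<in> ?I" for x
        using that A_inv[of x] by (simp add: valuation_ideal_def)
    qed (auto simp: valuation_ideal_def A_simps v_0_pos[simplified] intro: v_add_gt intro!: exI[of _ 0])
  qed (auto simp: valuation_ideal_def A_simps small_mult mult.commute)
  interpret Q: ring "residue_field v"
    unfolding residue_field_def by (rule I.quotient_is_ring)
  have pow: "\<one>\<^bsub>residue_field v\<^esub> [^]\<^bsub>add_monoid (residue_field v)\<^esub> k = ?I +>\<^bsub>?A\<^esub> of_nat k"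
    for k :: nat
  proof (induction k)
    case 0
    show ?case
      using I.a_rcos_const[of 0] v_0_pos
      by (simp add: nat_pow_def residue_field_def FactRing_def valuation_ideal_def)
  next
    case (Suc k)
    have "(?I +>\<^bsub>?A\<^esub> of_nat k) <+>\<^bsub>?A\<^esub> (?I +>\<^bsub>?A\<^esub> 1) = ?I +>\<^bsub>?A\<^esub> (of_nat k + 1)"
      using I.a_rcos_sum[of "of_nat k" 1] v_of_nat_nonneg[of k] by (simp add: A_simps)
    moreover have "\<one>\<^bsub>residue_field v\<^esub> [^]\<^bsub>add_monoid (residue_field v)\<^esub> Suc k
        = (?I +>\<^bsub>?A\<^esub> of_nat k) <+>\<^bsub>?A\<^esub> (?I +>\<^bsub>?A\<^esub> 1)"
      using Suc by (simp add: nat_pow_def residue_field_def FactRing_def A_simps)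
    ultimately show ?case by (simp add: add.commute)
  qed
  have "?I +>\<^bsub>?A\<^esub> of_nat n = ?I" using pos by (intro I.a_rcos_const) (simp add: valuation_ideal_def)
  then have "\<one>\<^bsub>residue_field v\<^esub> [^]\<^bsub>add_monoid (residue_field v)\<^esub> n = \<one>\<^bsub>add_monoid (residue_field v)\<^esub>"
    unfolding pow by (simp add: residue_field_def FactRing_def)
  then have "group.ord (add_monoid (residue_field v)) \<one>\<^bsub>residue_field v\<^esub> dvd n"
    using group.pow_eq_id[OF Q.a_group, of "\<one>\<^bsub>residue_field v\<^esub>" n] by simp
  then show False using char n by (simp add: ring_characteristic_def)
qed

text \<open>
  The prime field. Division by zero yields only \<open>0\<close>, so all quotients of integers may be admitted.
\<close>

lemma exists_trivially_valued_subfield: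
  assumes v_nat: "\<And>n. n > 0 \<Longrightarrow> v (of_nat n) = 0"
  shows "\<exists>P. is_subfield P \<and> (\<forall>x\<in>P. x \<noteq> 0 \<longrightarrow> v x = 0)"
proof (intro exI conjI ballI impI)
  define P where "P = {x. \<exists>m n. x = of_int m / (of_int n :: 'a)}"
  have v_int: "v (of_int m) = 0" if "m \<noteq> 0" for m
  proof (cases m rule: int_cases2)
    case (nonneg k)
    then show ?thesis using v_nat[of k] that by simp
  next
    case (nonpos k)
    then show ?thesis using v_nat[of k] that by simp
  qed
  show "is_subfield P"
    unfolding is_subfield_def
  proof (intro conjI ballI)
    show "1 \<in> P" unfolding P_def by (intro CollectI exI[of _ 1]) simp
  next
    fix x y assume "x \<in> P" "y \<in> P"
    then obtain k l m n where x: "x = of_int k / of_int l" and y: "y = of_int m / of_int n"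
      by (auto simp: P_def)
    show "x * y \<in> P"
      unfolding P_def x y by (intro CollectI exI[of _ "k * m"] exI[of _ "l * n"]) simp
    consider "of_int l = (0::'a)" | "of_int n = (0::'a)" | "of_int l \<noteq> (0::'a)" "of_int n \<noteq> (0::'a)"
      by blast
    then show "x - y \<in> P"
    proof cases
      case 1
      then have "x - y = of_int (- m) / of_int n" by (simp add: x y)
      then show ?thesis unfolding P_def by blast
    next
      case 2
      then have "x - y = of_int k / of_int l" by (simp add: x y)
      then show ?thesis unfolding P_def by blast
    next
      case 3
      then have "x - y = of_int (k * n - m * l) / of_int (l * n)" by (simp add: x y diff_frac_eq)
      then show ?thesis unfolding P_def by blast
    qed
  next
    fix x assume "x \<in> P"
    then obtain m n where "x = of_int m / of_int n" by (auto simp: P_def)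
    then have "inverse x = of_int n / of_int m" by simp
    then show "inverse x \<in> P" unfolding P_def by blast
  qed
  fix x assume "x \<in> P" "x \<noteq> 0"
  then obtain m n where x: "x = of_int m / of_int n"
    by (auto simp: P_def)
  then have "of_int n \<noteq> (0::'a)" "m \<noteq> 0" "n \<noteq> 0" using \<open>x \<noteq> 0\<close> by auto
  then show "v x = 0" using v_divide_eq v_int by (simp add: x)
qed

lemma exists_positive_value:
  assumes "nontrivial_valuation v"
  shows "\<exists>w. w \<noteq> 0 \<and> 0 < v w"
proof -
  have "0 \<in> value_group v"
    unfolding value_group_def by (intro CollectI exI[of _ 1]) (simp add: zero_extended_def)
  then obtain \<alpha> x where "\<alpha> \<noteq> 0" and x: "x \<noteq> 0" "v x = Fin \<alpha>"
    using assms by (auto simp: nontrivial_valuation_def value_group_def)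
  show ?thesis
  proof (cases "0 < \<alpha>")
    case True
    then show ?thesis using x by (intro exI[of _ x]) (simp add: zero_extended_def)
  next
    case False
    then have "v x < v 1" using x(2) \<open>\<alpha> \<noteq> 0\<close> by (simp add: zero_extended_def)
    then show ?thesis using v_divide_pos[of x 1] x(1) by (intro exI[of _ "1 / x"]) simp
  qed
qed

end

theorem theorem1:
  fixes v :: "'a::field \<Rightarrow> 'g::linordered_ab_group_add extended"
  assumes "krull_valuation v"
    and "nontrivial_valuation v"
    and "henselian v"
    and "ring_characteristic (residue_field v) = 0"
  shows "\<exists>K. subfield K ring_of_type_algebra \<and> K \<noteq> UNIV \<and> dense_subset v K \<and>
           algebraic_extension K"
proof -
  interpret krull_valuation v by fact
  note v_nat = v_of_nat[OF assms(4)]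
  have char_0: "of_nat n \<noteq> (0::'a)" if "n > 0" for n
    using v_nat[OF that] by (auto simp: zero_extended_def)
  obtain w where w: "w \<noteq> 0" "0 < v w" using exists_positive_value[OF assms(2)] by blast
  obtain P where P: "is_subfield P" "\<And>x. x \<in> P \<Longrightarrow> x \<noteq> 0 \<Longrightarrow> v x = 0"
    using exists_trivially_valued_subfield v_nat by blast
  have "\<exists>a K. is_subfield K \<and> a \<notin> K \<and> a \<in> valuation_closure v K"
  proof (cases "\<exists>x. x \<noteq> 0 \<and> 0 < v x \<and> \<not> (\<exists>z. z \<noteq> 0 \<and> infinitely_below x z)")
    case True
    then obtain a where a: "a \<noteq> 0" "0 < v a" "\<not> (\<exists>z. z \<noteq> 0 \<and> infinitely_below a z)" by blast
    then have "\<exists>n. v z \<le> v (a ^ n)" if "z \<noteq> 0" for z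
      using that by (auto simp: infinitely_below_def not_less)
    then show ?thesis using seed_if_powers_cofinal[OF P a(1,2)] by blast
  next
    case False
    then show ?thesis using seed_if_no_powers_cofinal[OF P w] by blast
  qed
  then obtain a K0 where "is_subfield K0" "a \<notin> K0" "a \<in> valuation_closure v K0" by blast
  then obtain K where K: "is_subfield K" "K \<noteq> UNIV" "valuation_closure v K = UNIV"
    and alg: "\<And>x. algebraic_over K x"
    using exists_dense_subfield_if_seed[OF assms(3) char_0 w] by blast
  have "dense_subset v K"
    unfolding dense_subset_def
  proof (intro allI ballI)
    fix x \<alpha> assume "\<alpha> \<in> value_group v"
    then obtain z where "z \<noteq> 0" "v z = Fin \<alpha>" by (auto simp: value_group_def)
    then show "\<exists>b\<in>K. Fin \<alpha> \<le> v (x - b)"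
      using valuation_closure_approx[of x K z] K(3) by (metis UNIV_I)
  qed
  moreover have "algebraic_extension K"
    unfolding algebraic_extension_def using algebraic_over_imp_algebraic[OF K(1) alg] by blast
  ultimately show ?thesis using is_subfield_imp_subfield[OF K(1)] K(2) by blast
qed

end
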